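(* Let $F$ be an endofunctor on a cocomplete (locally small) category $\mathcal C$. Then the equational classes of $F$-algebras coincide with the naturally induced classes of $F$-algebras. That is, a class $\mathcal K$ of $F$-algebras is of the form $\mathbf{Alg}(F,\mathcal E)$ for some class $\mathcal E$ of equation arrows if and only if it is of the form $\mathbf{Alg}(F,\mathcal I)$ for some class $\mathcal I$ of natural identities.
   Context: **Algebras.** An $F$-algebra is a pair $(A,\alpha)$ with $\alpha:FA\to A$ a morphism of $\mathcal C$; a morphism $(A,\alpha)\to(B,\beta)$ is a morphism $\phi:A\to B$ of $\mathcal C$ with $\phi\circ\alpha=\beta\circ F\phi$. The category of $F$-algebras is $\mathbf{Alg}\,F$. **Term functors.** By transfinite recursion define endofunctors $F_n$ of $\mathcal C$ ($n$ an ordinal) and natural transformations $w_{m,n}:F_m\to F_n$ ($m\le n$), forming a transfinite chain (so $w_{n,n}=\mathrm{id}$ and $w_{m,n}\circ w_{k,m}=w_{k,n}$). $F_0=\mathrm{Id}_{\mathcal C}$. $F_{n+1}=FF_n+\mathrm{Id}_{\mathcal C}$ with coproduct injections $q_n:FF_n\to F_{n+1}$ and $\iota_{n+1}=w_{0,n+1}:\mathrm{Id}_{\mathcal C}\to F_{n+1}$; $w_{m+1,n+1}=Fw_{m,n}+\mathrm{id}$, i.e. $w_{m+1,n+1}\circ q_m=q_n\circ Fw_{m,n}$ and $w_{m+1,n+1}\circ\iota_{m+1}=\iota_{n+1}$; for a limit ordinal $m$, $w_{m,m+1}$ is the unique factorization of the cocone $\{w_{k,m+1}\mid k<m\}$ through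 the colimit cocone $\{w_{k,m}\mid k<m\}$. For a limit ordinal $n$, $F_n=\operatorname{colim}_{m<n}F_m$ with colimit cocone $w_{m,n}$. **Term evaluation.** For an $F$-algebra $(A,\alpha)$ define $\epsilon_{n,(A,\alpha)}:F_nA\to A$ by $\epsilon_{0,(A,\alpha)}=\mathrm{id}_A$; $\epsilon_{n+1,(A,\alpha)}\circ q_{n,A}=\alpha\circ F\epsilon_{n,(A,\alpha)}$ and $\epsilon_{n+1,(A,\alpha)}\circ\iota_{n+1,A}=\mathrm{id}_A$; for a limit ordinal $l$, $\epsilon_{l,(A,\alpha)}$ is the unique morphism with $\epsilon_{l,(A,\alpha)}\circ w_{m,l,A}=\epsilon_{m,(A,\alpha)}$ for all $m<l$. **Equation arrows.** An equation arrow of arity $n$ over an object $X$ is a regular epimorphism $e:F_nX\to E$ in $\mathcal C$. An $F$-algebra $(A,\alpha)$ satisfies $e$ if for every $f:X\to A$ there is $h:E\to A$ with $\epsilon_{n,(A,\alpha)}\circ F_nf=h\circ e$. For a class $\mathcal E$ of equation arrows, $\mathbf{Alg}(F,\mathcal E)$ is the class (full subcategory of $\mathbf{Alg}\,F$) of all $F$-algebras satisfying every $e\in\mathcal E$; such classes are called equational. **Natural identities.** For an endofunctor $G$ of $\mathcal C$, an $n$-ary $G$-term is a natural transformation $\phi:G\to F_n$. A $G$-identity is a pair $(\phi,\psi)$ of $G$-terms $\phi:G\to F_m$, $\psi:G\to F_n$; a natural identity is a $G$-identity for some $G$. An $F$-algebra $(A,\alpha)$ satisfies $(\phi,\psi)$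 if $\epsilon_{m,(A,\alpha)}\circ\phi_A=\epsilon_{n,(A,\alpha)}\circ\psi_A$. For a class $\mathcal I$ of natural identities, $\mathbf{Alg}(F,\mathcal I)$ is the class (full subcategory of $\mathbf{Alg}\,F$) of all $F$-algebras satisfying every identity in $\mathcal I$; such classes are called naturally induced. *)

theory Defs
  imports Main
begin

unbundle cardinal_syntax

section \<open>Size\<close>

text \<open>
  HOL has no universal class of sets, so the distinction between small and large is made relative to
  a type \<open>'k\<close> whose elements play the role of all (small) ordinals: its order type is a regular
  strong limit cardinal, i.e. the height of a Grothendieck universe. A set of any type is small
  if its cardinality is below that of \<open>'k\<close>; a class is an arbitrary set. An axiom of infinity
  is not imposed, so \<^typ>\<open>nat\<close> (with small = finite) is an instance.
\<close>

class ordinals = wellorder +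
  assumes infinite_ordinals: "infinite (UNIV :: 'a set)"
    and initial_segment_small: "|{..<a}| <o |UNIV :: 'a set|"
    and regular: "|A| <o |UNIV :: 'a set| \<Longrightarrow> \<exists>b. \<forall>a\<in>A. a < b"
    and strong_limit: "|A| <o |UNIV :: 'a set| \<Longrightarrow> |Pow A| <o |UNIV :: 'a set|"

instance nat :: ordinals
proof
  have small_iff: "|A| <o |UNIV :: nat set| \<longleftrightarrow> finite A" for A :: "'b set"
    unfolding finite_iff_ordLess_natLeq
    using ordLess_ordIso_trans[OF _ card_of_nat]
      ordLess_ordIso_trans[OF _ ordIso_symmetric[OF card_of_nat]] by (rule iffI)
  show "infinite (UNIV :: nat set)" by simp
  show "|{..<a}| <o |UNIV :: nat set|" for a :: nat
    by (simp add: small_iff)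
  show "\<exists>b. \<forall>a\<in>A. a < b" if "|A| <o |UNIV :: nat set|" for A :: "nat set"
    using that by (simp add: small_iff finite_nat_set_iff_bounded)
  show "|Pow A| <o |UNIV :: nat set|" if "|A| <o |UNIV :: nat set|" for A :: "nat set"
    using that by (simp only: small_iff finite_Pow_iff)
qed

definition small :: "'k::ordinals itself \<Rightarrow> 'a set \<Rightarrow> bool" where
  "small _ A \<longleftrightarrow> |A| <o |UNIV :: 'k set|"

definition ord_zero :: "'k::ordinals" where
  "ord_zero = (LEAST n. True)"

definition ord_suc :: "'k::ordinals \<Rightarrow> 'k" where
  "ord_suc n = (LEAST m. n < m)"

definition ord_limit :: "'k::ordinals \<Rightarrow> bool" where
  "ord_limit n \<longleftrightarrow> n \<noteq> ord_zero \<and> (\<forall>m. n \<noteq> ord_suc m)"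


section \<open>Categories, functors and natural transformations\<close>

record ('o, 'm) cat =
  Obj :: "'o set"
  Arr :: "'m set"
  Dom :: "'m \<Rightarrow> 'o"
  Cod :: "'m \<Rightarrow> 'o"
  Ide :: "'o \<Rightarrow> 'm"
  Comp :: "'m \<Rightarrow> 'm \<Rightarrow> 'm"

abbreviation comp_in :: "'m \<Rightarrow> ('o, 'm) cat \<Rightarrow> 'm \<Rightarrow> 'm"
    (\<open>(_ \<cdot>\<^bsub>_\<^esub> _)\<close> [56, 0, 55] 55) where
  "g \<cdot>\<^bsub>C\<^esub> f \<equiv> Comp C g f"

definition hom :: "('o, 'm) cat \<Rightarrow> 'o \<Rightarrow> 'o \<Rightarrow> 'm set" where
  "hom C a b = {f \<in> Arr C. Dom C f = a \<and> Cod C f = b}"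

locale category =
  fixes C :: "('o, 'm) cat"
  assumes dom_cod: "f \<in> Arr C \<Longrightarrow> Dom C f \<in> Obj C \<and> Cod C f \<in> Obj C"
    and ide_hom: "a \<in> Obj C \<Longrightarrow> Ide C a \<in> hom C a a"
    and comp_hom: "\<lbrakk>f \<in> hom C a b; g \<in> hom C b c\<rbrakk> \<Longrightarrow> g \<cdot>\<^bsub>C\<^esub> f \<in> hom C a c"
    and ide_left: "f \<in> hom C a b \<Longrightarrow> Ide C b \<cdot>\<^bsub>C\<^esub> f = f"
    and ide_right: "f \<in> hom C a b \<Longrightarrow> f \<cdot>\<^bsub>C\<^esub> Ide C a = f"
    and comp_assoc: "\<lbrakk>f \<in> hom C a b; g \<in> hom C b c; h \<in> hom C c d\<rbrakk>
      \<Longrightarrow> (h \<cdot>\<^bsub>C\<^esub> g) \<cdot>\<^bsub>C\<^esub> f = h \<cdot>\<^bsub>C\<^esub> (g \<cdot>\<^bsub>C\<^esub> f)"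

record ('o1, 'm1, 'o2, 'm2) funct =
  on_obj :: "'o1 \<Rightarrow> 'o2"
  on_arr :: "'m1 \<Rightarrow> 'm2"

type_synonym ('o, 'm) endo = "('o, 'm, 'o, 'm) funct"

locale is_functor =
  fixes C :: "('o1, 'm1) cat" and D :: "('o2, 'm2) cat" and F :: "('o1, 'm1, 'o2, 'm2) funct"
  assumes on_obj: "a \<in> Obj C \<Longrightarrow> on_obj F a \<in> Obj D"
    and on_arr: "f \<in> hom C a b \<Longrightarrow> on_arr F f \<in> hom D (on_obj F a) (on_obj F b)"
    and on_ide: "a \<in> Obj C \<Longrightarrow> on_arr F (Ide C a) = Ide D (on_obj F a)"
    and on_comp: "\<lbrakk>f \<in> hom C a b; g \<in> hom C b c\<rbrakk>
      \<Longrightarrow> on_arr F (g \<cdot>\<^bsub>C\<^esub> f) = on_arr F g \<cdot>\<^bsub>D\<^esub> on_arr F f"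

definition comp_functor ::
    "('o2, 'm2, 'o3, 'm3) funct \<Rightarrow> ('o1, 'm1, 'o2, 'm2) funct \<Rightarrow> ('o1, 'm1, 'o3, 'm3) funct" where
  "comp_functor G F = \<lparr>on_obj = on_obj G \<circ> on_obj F, on_arr = on_arr G \<circ> on_arr F\<rparr>"

definition nat_trans ::
    "('o1, 'm1) cat \<Rightarrow> ('o2, 'm2) cat \<Rightarrow> ('o1, 'm1, 'o2, 'm2) funct \<Rightarrow>
     ('o1, 'm1, 'o2, 'm2) funct \<Rightarrow> ('o1 \<Rightarrow> 'm2) \<Rightarrow> bool" where
  "nat_trans C D F G t \<longleftrightarrow>
     (\<forall>a\<in>Obj C. t a \<in> hom D (on_obj F a) (on_obj G a)) \<and>
     (\<forall>a\<in>Obj C. \<forall>b\<in>Obj C. \<forall>f\<in>hom C a b. t b \<cdot>\<^bsub>D\<^esub> on_arr F f = on_arr G f \<cdot>\<^bsub>D\<^esub> t a)"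

definition locally_small :: "'k::ordinals itself \<Rightarrow> ('o, 'm) cat \<Rightarrow> bool" where
  "locally_small U C \<longleftrightarrow> (\<forall>a\<in>Obj C. \<forall>b\<in>Obj C. small U (hom C a b))"


section \<open>Colimits\<close>

definition cocone ::
    "('i, 'j) cat \<Rightarrow> ('o, 'm) cat \<Rightarrow> ('i, 'j, 'o, 'm) funct \<Rightarrow> 'o \<Rightarrow> ('i \<Rightarrow> 'm) \<Rightarrow> bool" where
  "cocone J C D a c \<longleftrightarrow> a \<in> Obj C \<and>
     (\<forall>i\<in>Obj J. c i \<in> hom C (on_obj D i) a) \<and>
     (\<forall>u\<in>Arr J. c (Cod J u) \<cdot>\<^bsub>C\<^esub> on_arr D u = c (Dom J u))"

definition colimit ::
    "('i, 'j) cat \<Rightarrow> ('o, 'm) cat \<Rightarrow> ('i, 'j, 'o, 'm) funct \<Rightarrow> 'o \<Rightarrow> ('i \<Rightarrow> 'm) \<Rightarrow> bool" where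
  "colimit J C D a c \<longleftrightarrow> cocone J C D a c \<and>
     (\<forall>b d. cocone J C D b d \<longrightarrow>
        (\<exists>!h. h \<in> hom C a b \<and> (\<forall>i\<in>Obj J. h \<cdot>\<^bsub>C\<^esub> c i = d i)))"

text \<open>
  Every small category is isomorphic to one whose objects and arrows are elements of \<open>'k\<close>, so it
  suffices to let the index categories range over those.
\<close>

definition cocomplete :: "'k::ordinals itself \<Rightarrow> ('o, 'm) cat \<Rightarrow> bool" where
  "cocomplete U C \<longleftrightarrow>
     (\<forall>(J :: ('k, 'k) cat) D. category J \<and> small U (Obj J) \<and> small U (Arr J) \<and> is_functor J C D
        \<longrightarrow> (\<exists>a c. colimit J C D a c))"

definition coproduct :: "('o, 'm) cat \<Rightarrow> 'o \<Rightarrow> 'o \<Rightarrow> 'o \<Rightarrow> 'm \<Rightarrow> 'm \<Rightarrow> bool" where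
  "coproduct C a b s i j \<longleftrightarrow> s \<in> Obj C \<and> i \<in> hom C a s \<and> j \<in> hom C b s \<and>
     (\<forall>c\<in>Obj C. \<forall>f\<in>hom C a c. \<forall>g\<in>hom C b c.
        \<exists>!h. h \<in> hom C s c \<and> h \<cdot>\<^bsub>C\<^esub> i = f \<and> h \<cdot>\<^bsub>C\<^esub> j = g)"

definition coequalizer :: "('o, 'm) cat \<Rightarrow> 'o \<Rightarrow> 'o \<Rightarrow> 'm \<Rightarrow> 'm \<Rightarrow> 'o \<Rightarrow> 'm \<Rightarrow> bool" where
  "coequalizer C a b r s c e \<longleftrightarrow> r \<in> hom C a b \<and> s \<in> hom C a b \<and> e \<in> hom C b c \<and>
     e \<cdot>\<^bsub>C\<^esub> r = e \<cdot>\<^bsub>C\<^esub> s \<and>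
     (\<forall>d\<in>Obj C. \<forall>f\<in>hom C b d. f \<cdot>\<^bsub>C\<^esub> r = f \<cdot>\<^bsub>C\<^esub> s \<longrightarrow> (\<exists>!h. h \<in> hom C c d \<and> h \<cdot>\<^bsub>C\<^esub> e = f))"

definition regular_epi :: "('o, 'm) cat \<Rightarrow> 'm \<Rightarrow> bool" where
  "regular_epi C e \<longleftrightarrow> (\<exists>a r s. coequalizer C a (Dom C e) r s (Cod C e) e)"

definition below :: "'k::ordinals \<Rightarrow> ('k, 'k \<times> 'k) cat" where
  "below n = \<lparr>Obj = {..<n}, Arr = {(i, j). i \<le> j \<and> j < n}, Dom = fst, Cod = snd,
     Ide = (\<lambda>i. (i, i)), Comp = (\<lambda>u v. (fst v, snd u))\<rparr>"


section \<open>Algebras and term functors\<close>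

definition algebras :: "('o, 'm) cat \<Rightarrow> ('o, 'm) endo \<Rightarrow> ('o \<times> 'm) set" where
  "algebras C F = {(A, \<alpha>). A \<in> Obj C \<and> \<alpha> \<in> hom C (on_obj F A) A}"

record ('k, 'o, 'm) term_chain =
  trm :: "'k \<Rightarrow> ('o, 'm) endo"
  lnk :: "'k \<Rightarrow> 'k \<Rightarrow> 'o \<Rightarrow> 'm"
  qinj :: "'k \<Rightarrow> 'o \<Rightarrow> 'm"

text \<open>
  For a term chain \<open>T\<close>, \<open>trm T n\<close> is \<open>F\<^sub>n\<close>, \<open>lnk T m n\<close> is \<open>w\<^sub>m\<^sub>,\<^sub>n\<close> (meaningful for
  \<open>m \<le> n\<close>), and \<open>qinj T n\<close> is \<open>q\<^sub>n\<close>; the injection \<open>\<iota>\<close> into the functor at a successor \<open>n\<close>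
  is \<open>lnk T 0 n\<close>. Colimits of endofunctors are taken pointwise; naturality of the injections
  then determines the action on arrows. The chain law contains the remaining two clauses of the
  recursion, namely compatibility of \<open>w\<close> with \<open>\<iota>\<close> and, for a limit \<open>m\<close>, that \<open>w\<^sub>m\<^sub>,\<^sub>m\<^sub>+\<^sub>1\<close> is
  the factorization of the cocone \<open>w\<^sub>k\<^sub>,\<^sub>m\<^sub>+\<^sub>1\<close> through the colimit cocone \<open>w\<^sub>k\<^sub>,\<^sub>m\<close>.
\<close>

definition is_term_chain ::
    "('o, 'm) cat \<Rightarrow> ('o, 'm) endo \<Rightarrow> ('k::ordinals, 'o, 'm) term_chain \<Rightarrow> bool" where
  "is_term_chain C F T \<longleftrightarrow>
     (\<forall>n. is_functor C C (trm T n)) \<and>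
     (\<forall>m n. m \<le> n \<longrightarrow> nat_trans C C (trm T m) (trm T n) (lnk T m n)) \<and>
     (\<forall>n. \<forall>A\<in>Obj C. lnk T n n A = Ide C (on_obj (trm T n) A)) \<and>
     (\<forall>k m n. \<forall>A\<in>Obj C. k \<le> m \<and> m \<le> n \<longrightarrow> lnk T m n A \<cdot>\<^bsub>C\<^esub> lnk T k m A = lnk T k n A) \<and>
     (\<forall>A\<in>Obj C. on_obj (trm T ord_zero) A = A) \<and>
     (\<forall>f\<in>Arr C. on_arr (trm T ord_zero) f = f) \<and>
     (\<forall>n. nat_trans C C (comp_functor F (trm T n)) (trm T (ord_suc n)) (qinj T n)) \<and>
     (\<forall>n. \<forall>A\<in>Obj C. coproduct C (on_obj F (on_obj (trm T n) A)) A (on_obj (trm T (ord_suc n)) A)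
        (qinj T n A) (lnk T ord_zero (ord_suc n) A)) \<and>
     (\<forall>m n. \<forall>A\<in>Obj C. m \<le> n \<longrightarrow>
        lnk T (ord_suc m) (ord_suc n) A \<cdot>\<^bsub>C\<^esub> qinj T m A
          = qinj T n A \<cdot>\<^bsub>C\<^esub> on_arr F (lnk T m n A)) \<and>
     (\<forall>n. \<forall>A\<in>Obj C. ord_limit n \<longrightarrow>
        colimit (below n) C
          \<lparr>on_obj = \<lambda>m. on_obj (trm T m) A, on_arr = \<lambda>(i, j). lnk T i j A\<rparr>
          (on_obj (trm T n) A) (\<lambda>m. lnk T m n A))"

text \<open>The choice reflects the choice of a colimit at each stage of the recursion.\<close>

definition term_chain_of :: "('o, 'm) cat \<Rightarrow> ('o, 'm) endo \<Rightarrow> ('k::ordinals, 'o, 'm) term_chain" where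
  "term_chain_of C F = (SOME T. is_term_chain C F T)"

abbreviation term_functor :: "('o, 'm) cat \<Rightarrow> ('o, 'm) endo \<Rightarrow> 'k::ordinals \<Rightarrow> ('o, 'm) endo" where
  "term_functor C F n \<equiv> trm (term_chain_of C F) n"

abbreviation term_link ::
    "('o, 'm) cat \<Rightarrow> ('o, 'm) endo \<Rightarrow> 'k::ordinals \<Rightarrow> 'k \<Rightarrow> 'o \<Rightarrow> 'm" where
  "term_link C F m n \<equiv> lnk (term_chain_of C F) m n"

abbreviation term_inj :: "('o, 'm) cat \<Rightarrow> ('o, 'm) endo \<Rightarrow> 'k::ordinals \<Rightarrow> 'o \<Rightarrow> 'm" where
  "term_inj C F n \<equiv> qinj (term_chain_of C F) n"

definition is_term_eval ::
    "('o, 'm) cat \<Rightarrow> ('o, 'm) endo \<Rightarrow> 'o \<times> 'm \<Rightarrow> ('k::ordinals \<Rightarrow> 'm) \<Rightarrow> bool" where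
  "is_term_eval C F = (\<lambda>(A, \<alpha>) \<epsilon>.
     (\<forall>n. \<epsilon> n \<in> hom C (on_obj (term_functor C F n) A) A) \<and>
     \<epsilon> ord_zero = Ide C A \<and>
     (\<forall>n. \<epsilon> (ord_suc n) \<cdot>\<^bsub>C\<^esub> term_inj C F n A = \<alpha> \<cdot>\<^bsub>C\<^esub> on_arr F (\<epsilon> n)) \<and>
     (\<forall>n. \<epsilon> (ord_suc n) \<cdot>\<^bsub>C\<^esub> term_link C F ord_zero (ord_suc n) A = Ide C A) \<and>
     (\<forall>l m. ord_limit l \<and> m < l \<longrightarrow> \<epsilon> l \<cdot>\<^bsub>C\<^esub> term_link C F m l A = \<epsilon> m))"

definition term_eval :: "('o, 'm) cat \<Rightarrow> ('o, 'm) endo \<Rightarrow> 'o \<times> 'm \<Rightarrow> 'k::ordinals \<Rightarrow> 'm" where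
  "term_eval C F alg = (THE \<epsilon>. is_term_eval C F alg \<epsilon>)"


section \<open>Equation arrows and natural identities\<close>

text \<open>An equation arrow over \<open>X\<close> of arity \<open>n\<close> is a triple \<open>(X, n, e)\<close>.\<close>

definition equation_arrows :: "('o, 'm) cat \<Rightarrow> ('o, 'm) endo \<Rightarrow> ('o \<times> 'k::ordinals \<times> 'm) set" where
  "equation_arrows C F =
     {(X, n, e). X \<in> Obj C \<and> regular_epi C e \<and> Dom C e = on_obj (term_functor C F n) X}"

definition satisfies_equation ::
    "('o, 'm) cat \<Rightarrow> ('o, 'm) endo \<Rightarrow> 'o \<times> 'm \<Rightarrow> 'o \<times> 'k::ordinals \<times> 'm \<Rightarrow> bool" where
  "satisfies_equation C F = (\<lambda>(A, \<alpha>) (X, n, e).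
     \<forall>f\<in>hom C X A. \<exists>h\<in>hom C (Cod C e) A.
       term_eval C F (A, \<alpha>) n \<cdot>\<^bsub>C\<^esub> on_arr (term_functor C F n) f = h \<cdot>\<^bsub>C\<^esub> e)"

definition Alg_equations ::
    "('o, 'm) cat \<Rightarrow> ('o, 'm) endo \<Rightarrow> ('o \<times> 'k::ordinals \<times> 'm) set \<Rightarrow> ('o \<times> 'm) set" where
  "Alg_equations C F \<E> = {a \<in> algebras C F. \<forall>e\<in>\<E>. satisfies_equation C F a e}"

text \<open>
  A natural identity is a tuple \<open>(G, (m, \<phi>), (n, \<psi>))\<close> of an endofunctor \<open>G\<close> and two \<open>G\<close>-terms with
  their arities.
\<close>

type_synonym ('k, 'o, 'm) nat_identity =
  "('o, 'm) endo \<times> ('k \<times> ('o \<Rightarrow> 'm)) \<times> ('k \<times> ('o \<Rightarrow> 'm))"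

definition G_terms ::
    "('o, 'm) cat \<Rightarrow> ('o, 'm) endo \<Rightarrow> ('o, 'm) endo \<Rightarrow> ('k::ordinals \<times> ('o \<Rightarrow> 'm)) set" where
  "G_terms C F G = {(n, \<phi>). nat_trans C C G (term_functor C F n) \<phi>}"

definition natural_identities ::
    "('o, 'm) cat \<Rightarrow> ('o, 'm) endo \<Rightarrow> ('k::ordinals, 'o, 'm) nat_identity set" where
  "natural_identities C F =
     {(G, s, t). is_functor C C G \<and> s \<in> G_terms C F G \<and> t \<in> G_terms C F G}"

definition satisfies_identity ::
    "('o, 'm) cat \<Rightarrow> ('o, 'm) endo \<Rightarrow> 'o \<times> 'm \<Rightarrow> ('k::ordinals, 'o, 'm) nat_identity \<Rightarrow> bool" where
  "satisfies_identity C F = (\<lambda>(A, \<alpha>) (G, (m, \<phi>), (n, \<psi>)).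
     term_eval C F (A, \<alpha>) m \<cdot>\<^bsub>C\<^esub> \<phi> A = term_eval C F (A, \<alpha>) n \<cdot>\<^bsub>C\<^esub> \<psi> A)"

definition Alg_identities ::
    "('o, 'm) cat \<Rightarrow> ('o, 'm) endo \<Rightarrow> ('k::ordinals, 'o, 'm) nat_identity set \<Rightarrow> ('o \<times> 'm) set" where
  "Alg_identities C F \<I> = {a \<in> algebras C F. \<forall>i\<in>\<I>. satisfies_identity C F a i}"

end

theory Submission
  imports Defs
begin

text \<open>
  An equation arrow over \<open>X\<close> is the coequalizer of some \<open>r, s : R \<rightarrow> F\<^sub>n X\<close>. By the Yoneda lemma, \<open>r\<close>
  and \<open>s\<close> are the same as natural transformations to \<open>F\<^sub>n\<close> from the copower \<open>G A = hom(X, A) \<bullet> R\<close>,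
  which exists since \<open>hom(X, A)\<close> is small; an algebra satisfies this \<open>G\<close>-identity iff it satisfies the
  equation. Conversely, given a \<open>G\<close>-identity, made of equal arities by composing with a link,
  the coequalizers of its components at all objects \<open>X\<close> form a class of equation arrows. Naturality
  shows that the identity implies the equations, and the equation over \<open>A\<close> at \<open>f = id\<close> gives the
  identity in \<open>(A, \<alpha>)\<close>.

  To see that the term chain exists, note that \<open>F\<^sub>n A\<close> has one universal property for all \<open>n\<close>, whether
  zero, successor or limit: it is initial among the objects equipped with a map from \<open>A\<close> and
  compatible maps from \<open>F F\<^sub>k A\<close> for all \<open>k < n\<close>. Hence the transfinite recursion needs no case
  distinction, and the action of \<open>F\<^sub>n\<close> on arrows and the term evaluation both arise from a single
  principle for maps out of such a chain.
\<close>


section \<open>Ordinals and smallness\<close>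

lemma small_finite: "finite A \<Longrightarrow> small (U :: 'k::ordinals itself) A"
  using finite_ordLess_infinite[OF card_of_Well_order[of A] card_of_Well_order[of "UNIV :: 'k set"]]
    infinite_ordinals
  unfolding small_def by (simp add: Field_card_of)

section \<open>Zero, successor and limit ordinals\<close>

lemma ord_zero_le [simp]: "ord_zero \<le> (n :: 'k::ordinals)"
  unfolding ord_zero_def by (rule Least_le) simp

lemma not_less_ord_zero [simp]: "\<not> (n :: 'k::ordinals) < ord_zero"
  by (simp add: not_less)

text \<open>Regularity applied to a singleton bounds it strictly, so there is no largest ordinal.
  This makes the \<open>LEAST\<close> in \<open>ord_suc\<close> range over a nonempty set.\<close>

lemma ex_greater_ordinal: "\<exists>m. (n :: 'k::ordinals) < m"
  using regular[of "{n}"] small_finite[of "{n}"] unfolding small_def by auto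

lemma less_ord_suc [simp]: "(n :: 'k::ordinals) < ord_suc n"
  unfolding ord_suc_def using ex_greater_ordinal by (rule LeastI_ex)

lemma ord_suc_le_iff: "ord_suc m \<le> n \<longleftrightarrow> m < (n :: 'k::ordinals)"
proof
  show "m < n" if "ord_suc m \<le> n" using less_ord_suc that by (rule less_le_trans)
  show "ord_suc m \<le> n" if "m < n" unfolding ord_suc_def using that by (rule Least_le)
qed

lemma less_ord_suc_iff: "m < ord_suc n \<longleftrightarrow> m \<le> (n :: 'k::ordinals)"
  using ord_suc_le_iff[of n m] by (meson not_le)

lemma ord_suc_le_ord_suc [simp]: "ord_suc m \<le> ord_suc n \<longleftrightarrow> m \<le> (n :: 'k::ordinals)"
  by (simp add: ord_suc_le_iff less_ord_suc_iff)

lemma ord_cases [case_names zero suc limit]: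
  fixes n :: "'k::ordinals"
  obtains "n = ord_zero" | m where "n = ord_suc m" | "ord_limit n"
  unfolding ord_limit_def by blast

lemma ord_limit_zero: "ord_limit n \<Longrightarrow> ord_zero < (n :: 'k::ordinals)"
  unfolding ord_limit_def by (auto simp: less_le)

lemma ord_limit_suc: "\<lbrakk>ord_limit n; m < n\<rbrakk> \<Longrightarrow> ord_suc m < (n :: 'k::ordinals)"
  unfolding ord_limit_def by (metis ord_suc_le_iff less_le)

section \<open>Closure properties of smallness\<close>

lemma small_segment: "small (U :: 'k::ordinals itself) {..<n :: 'k}"
  unfolding small_def by (rule initial_segment_small)

lemma small_image: "small U A \<Longrightarrow> small U (f ` A)"
  unfolding small_def by (rule ordLeq_ordLess_trans[OF card_of_image])

lemma small_subset: "\<lbrakk>small U B; A \<subseteq> B\<rbrakk> \<Longrightarrow> small U A"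
  unfolding small_def by (rule ordLeq_ordLess_trans[OF card_of_mono1])

lemma small_insert: "small U A \<Longrightarrow> small (U :: 'k::ordinals itself) (insert a A)"
  using card_of_Un_ordLess_infinite[OF infinite_ordinals, of "{a}" A] small_finite[of "{a}" U]
  unfolding small_def by simp

text \<open>An infinite set is equipotent to its square. The bound is used for the arrows of a small
  preorder, which are pairs of elements.\<close>

lemma small_square: "small U A \<Longrightarrow> small (U :: 'k::ordinals itself) (A \<times> A)"
proof (cases "finite A")
  case False
  assume "small U A"
  with card_of_Times_same_infinite[OF False] show ?thesis
    unfolding small_def by (rule ordIso_ordLess_trans)
qed (simp add: small_finite)

text \<open>The cardinal inequality unfolds to an embedding into the type of ordinals. It lets index
  categories of any type be relocated to the type over which \<open>cocomplete\<close>
  quantifies.\<close>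

lemma small_inj:
  fixes U :: "'k::ordinals itself"
  assumes "small U A"
  obtains f :: "'a \<Rightarrow> 'k" where "inj_on f A"
  using ordLess_imp_ordLeq[OF assms[unfolded small_def]]
  unfolding card_of_ordLeq[symmetric] by (auto intro: that)


section \<open>Small colimits\<close>

lemma homD: "f \<in> hom C a b \<Longrightarrow> f \<in> Arr C \<and> Dom C f = a \<and> Cod C f = b"
  by (simp add: hom_def)

context category
begin

lemma hom_obj: "f \<in> hom C a b \<Longrightarrow> a \<in> Obj C" "f \<in> hom C a b \<Longrightarrow> b \<in> Obj C"
  using dom_cod by (auto simp: hom_def)

lemma arr_hom: "f \<in> Arr C \<Longrightarrow> f \<in> hom C (Dom C f) (Cod C f)"
  by (simp add: hom_def)

text \<open>Cocompleteness speaks only of index categories built from elements of \<open>'k\<close>.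
  Objects and arrows of \<open>J\<close> are encoded there by injections, the diagram is transported
  along the encoding, and its colimit is read back.\<close>

lemma small_colimit:
  fixes U :: "'k::ordinals itself" and J :: "('i, 'j) cat"
  assumes coc: "cocomplete U C" and J: "category J"
    and small: "small U (Obj J)" "small U (Arr J)"
    and D: "is_functor J C D"
  shows "\<exists>a c. colimit J C D a c"
proof -
  interpret J: category J by (rule J)
  interpret D: is_functor J C D by (rule D)
  obtain f :: "'i \<Rightarrow> 'k" where f: "inj_on f (Obj J)" using small(1) by (rule small_inj)
  obtain g :: "'j \<Rightarrow> 'k" where g: "inj_on g (Arr J)" using small(2) by (rule small_inj)
  define f' where "f' = inv_into (Obj J) f"
  define g' where "g' = inv_into (Arr J) g"
  have f': "f' (f x) = x" if "x \<in> Obj J" for x using f that by (simp add: f'_def)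
  have g': "g' (g u) = u" if "u \<in> Arr J" for u using g that by (simp add: g'_def)
  \<comment> \<open>The isomorphic copy of \<open>J\<close>: every operation decodes with
    \<open>f'\<close> and \<open>g'\<close>, acts in \<open>J\<close>, and encodes again.\<close>
  define J' :: "('k, 'k) cat" where "J' = \<lparr>Obj = f ` Obj J, Arr = g ` Arr J,
    Dom = (\<lambda>u. f (Dom J (g' u))), Cod = (\<lambda>u. f (Cod J (g' u))),
    Ide = (\<lambda>x. g (Ide J (f' x))), Comp = (\<lambda>u v. g (Comp J (g' u) (g' v)))\<rparr>"
  have homE: "\<exists>x y v. a = f x \<and> b = f y \<and> u = g v \<and> v \<in> hom J x y \<and> x \<in> Obj J \<and> y \<in> Obj J"
    if "u \<in> hom J' a b" for u a b
    using that J.dom_cod by (simp add: J'_def hom_def) (metis g' imageE)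
  have hom_iff: "g v \<in> hom J' (f x) (f y)" if "v \<in> hom J x y" for v x y
    using that by (auto simp: J'_def hom_def g')
  have comp_eq: "Comp J' (g v) (g u) = g (Comp J v u)" if "u \<in> hom J x y" "v \<in> hom J y z"
    for u v x y z using that by (simp add: J'_def hom_def g')
  have ide_eq: "Ide J' (f x) = g (Ide J x)" if "x \<in> Obj J" for x
    using that by (simp add: J'_def f')
  have obj_eq: "Obj J' = f ` Obj J" and arr_eq: "Arr J' = g ` Arr J" by (simp_all add: J'_def)
  note feq = inj_on_eq_iff[OF f]
  have J': "category J'"
  proof
    show "Dom J' u \<in> Obj J' \<and> Cod J' u \<in> Obj J'" if "u \<in> Arr J'" for u
      using that J.dom_cod by (auto simp: J'_def g')
    show "Ide J' a \<in> hom J' a a" if "a \<in> Obj J'" for a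
      using that hom_iff[OF J.ide_hom] by (auto simp: obj_eq ide_eq)
    show "Comp J' v u \<in> hom J' a c" if u: "u \<in> hom J' a b" and v: "v \<in> hom J' b c" for u v a b c
      using homE[OF u] homE[OF v] hom_iff[OF J.comp_hom] by (auto simp: feq comp_eq)
    show "Comp J' (Ide J' b) u = u" if u: "u \<in> hom J' a b" for u a b
      using homE[OF u] by (auto simp: ide_eq comp_eq[OF _ J.ide_hom] J.ide_left)
    show "Comp J' u (Ide J' a) = u" if u: "u \<in> hom J' a b" for u a b
      using homE[OF u] by (auto simp: ide_eq comp_eq[OF J.ide_hom] J.ide_right)
    show "Comp J' (Comp J' w v) u = Comp J' w (Comp J' v u)"
      if u: "u \<in> hom J' a b" and v: "v \<in> hom J' b c" and w: "w \<in> hom J' c d" for u v w a b c d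
    proof -
      from homE[OF u] homE[OF v] homE[OF w] obtain u' v' w' x y z t where
        "u = g u'" "v = g v'" "w = g w'" and h: "u' \<in> hom J x y" "v' \<in> hom J y z" "w' \<in> hom J z t"
        by (auto simp: feq)
      then show ?thesis
        by (simp add: comp_eq[OF h(1,2)] comp_eq[OF h(2,3)] comp_eq[OF h(1) J.comp_hom[OF h(2,3)]]
            comp_eq[OF J.comp_hom[OF h(1,2)] h(3)] J.comp_assoc[OF h])
    qed
  qed
  define D' where "D' = \<lparr>on_obj = on_obj D \<circ> f', on_arr = on_arr D \<circ> g'\<rparr>"
  have D'_obj: "on_obj D' (f x) = on_obj D x" if "x \<in> Obj J" for x using that by (simp add: D'_def f')
  have D'_hom: "on_arr D' (g u) = on_arr D u" if "u \<in> hom J x y" for u x y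
    using that by (simp add: D'_def g' hom_def)
  have D'_arr: "on_arr D' (g u) = on_arr D u" if "u \<in> Arr J" for u using that by (simp add: D'_def g')
  have "is_functor J' C D'"
  proof
    show "on_obj D' a \<in> Obj C" if "a \<in> Obj J'" for a
      using that by (auto simp: obj_eq D'_obj D.on_obj)
    show "on_arr D' u \<in> hom C (on_obj D' a) (on_obj D' b)" if "u \<in> hom J' a b" for u a b
      using homE[OF that] D.on_arr by (auto simp: D'_obj D'_hom)
    show "on_arr D' (Ide J' a) = Ide C (on_obj D' a)" if "a \<in> Obj J'" for a
      using that homD[OF J.ide_hom] by (auto simp: obj_eq ide_eq D'_obj D'_arr D.on_ide)
    show "on_arr D' (Comp J' v u) = on_arr D' v \<cdot>\<^bsub>C\<^esub> on_arr D' u"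
      if u: "u \<in> hom J' a b" and v: "v \<in> hom J' b c" for u v a b c
    proof -
      from homE[OF u] homE[OF v] obtain u' v' x y z where
        "u = g u'" "v = g v'" and h: "u' \<in> hom J x y" "v' \<in> hom J y z"
        by (auto simp: feq)
      then show ?thesis
        using homD[OF h(1)] homD[OF h(2)] homD[OF J.comp_hom[OF h]]
        by (simp add: comp_eq[OF h] D'_arr D.on_comp[OF h])
    qed
  qed
  moreover have "small U (Obj J')" "small U (Arr J')"
    using small by (simp_all add: obj_eq arr_eq small_image)
  ultimately obtain a c where ac: "colimit J' C D' a c"
    using coc J' unfolding cocomplete_def by blast
  have cocone_iff: "cocone J' C D' b d \<longleftrightarrow> cocone J C D b (d \<circ> f)" for b d
    using J.dom_cod by (auto simp: cocone_def obj_eq arr_eq D'_obj D'_arr J'_def g')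
  have "colimit J C D a (c \<circ> f)"
    unfolding colimit_def
  proof (intro conjI allI impI)
    show "cocone J C D a (c \<circ> f)" using ac by (simp add: colimit_def cocone_iff)
    fix b d assume "cocone J C D b d"
    \<comment> \<open>Rewriting \<open>d\<close> on \<open>Obj J\<close> as a family precomposed
      with the encoding \<open>f\<close> lets \<open>cocone_iff\<close> turn it into a cocone over
      \<open>J'\<close>.\<close>
    then have "cocone J C D b ((d \<circ> f') \<circ> f)"
      using J.dom_cod by (auto simp: cocone_def f')
    then have "\<exists>!h. h \<in> hom C a b \<and> (\<forall>i\<in>Obj J'. h \<cdot>\<^bsub>C\<^esub> c i = (d \<circ> f') i)"
      using ac unfolding colimit_def cocone_iff by blast
    then show "\<exists>!h. h \<in> hom C a b \<and> (\<forall>i\<in>Obj J. h \<cdot>\<^bsub>C\<^esub> (c \<circ> f) i = d i)"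
      by (simp add: obj_eq f')
  qed
  then show ?thesis by blast
qed

text \<open>The universal property is spelled out elementwise, so that no index category appears in
  applications. It serves two of them: the free cones of the term chain, and copowers, where the
  preorder is equality.\<close>

lemma preorder_colimit:
  fixes U :: "'k::ordinals itself"
  assumes coc: "cocomplete U C" and small: "small U S"
    and R_refl: "\<And>x. x \<in> S \<Longrightarrow> R x x"
    and R_trans: "\<And>x y z. \<lbrakk>R x y; R y z\<rbrakk> \<Longrightarrow> R x z"
    and D: "\<And>x. x \<in> S \<Longrightarrow> D x \<in> Obj C"
    and d: "\<And>x y. \<lbrakk>x \<in> S; y \<in> S; R x y\<rbrakk> \<Longrightarrow> d x y \<in> hom C (D x) (D y)"
    and d_refl: "\<And>x. x \<in> S \<Longrightarrow> d x x = Ide C (D x)"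
    and d_trans: "\<And>x y z. \<lbrakk>x \<in> S; y \<in> S; z \<in> S; R x y; R y z\<rbrakk> \<Longrightarrow> d y z \<cdot>\<^bsub>C\<^esub> d x y = d x z"
  obtains a c where "a \<in> Obj C" "\<And>x. x \<in> S \<Longrightarrow> c x \<in> hom C (D x) a"
    "\<And>x y. \<lbrakk>x \<in> S; y \<in> S; R x y\<rbrakk> \<Longrightarrow> c y \<cdot>\<^bsub>C\<^esub> d x y = c x"
    "\<And>b e. \<lbrakk>b \<in> Obj C; \<And>x. x \<in> S \<Longrightarrow> e x \<in> hom C (D x) b;
        \<And>x y. \<lbrakk>x \<in> S; y \<in> S; R x y\<rbrakk> \<Longrightarrow> e y \<cdot>\<^bsub>C\<^esub> d x y = e x\<rbrakk>
      \<Longrightarrow> \<exists>!h. h \<in> hom C a b \<and> (\<forall>x\<in>S. h \<cdot>\<^bsub>C\<^esub> c x = e x)"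
proof -
  define J where "J = \<lparr>Obj = S, Arr = {(x, y). x \<in> S \<and> y \<in> S \<and> R x y}, Dom = fst, Cod = snd,
    Ide = (\<lambda>x. (x, x)), Comp = (\<lambda>u v. (fst v, snd u))\<rparr>"
  define E where "E = \<lparr>on_obj = D, on_arr = (\<lambda>(x, y). d x y)\<rparr>"
  have J_hom: "u \<in> hom J x y \<longleftrightarrow> u = (x, y) \<and> x \<in> S \<and> y \<in> S \<and> R x y" for u x y
    by (auto simp: J_def hom_def)
  have J_simps: "Obj J = S" "Ide J = (\<lambda>x. (x, x))" "Comp J = (\<lambda>u v. (fst v, snd u))"
    by (simp_all add: J_def)
  have "category J"
    using R_refl
    by unfold_locales (simp add: J_def split: prod.splits, auto simp: J_hom J_simps intro: R_trans)
  moreover have "is_functor J C E"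
    using D d d_refl d_trans by unfold_locales (auto simp: J_hom J_simps E_def)
  moreover have "small U (Obj J)" using small by (simp add: J_def)
  moreover have "small U (Arr J)"
    by (rule small_subset[OF small_square[OF small]]) (auto simp: J_def)
  ultimately obtain a c where ac: "colimit J C E a c" using small_colimit[OF coc] by blast
  have cocone_iff: "cocone J C E b e \<longleftrightarrow> b \<in> Obj C \<and> (\<forall>x\<in>S. e x \<in> hom C (D x) b) \<and>
      (\<forall>x y. x \<in> S \<and> y \<in> S \<and> R x y \<longrightarrow> e y \<cdot>\<^bsub>C\<^esub> d x y = e x)" for b e
    by (auto simp: cocone_def J_def E_def)
  show thesis
  proof
    show "a \<in> Obj C" "\<And>x. x \<in> S \<Longrightarrow> c x \<in> hom C (D x) a"
      "\<And>x y. \<lbrakk>x \<in> S; y \<in> S; R x y\<rbrakk> \<Longrightarrow> c y \<cdot>\<^bsub>C\<^esub> d x y = c x"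
      using ac by (auto simp: colimit_def cocone_iff)
    fix b e
    assume "b \<in> Obj C" "\<And>x. x \<in> S \<Longrightarrow> e x \<in> hom C (D x) b"
      "\<And>x y. \<lbrakk>x \<in> S; y \<in> S; R x y\<rbrakk> \<Longrightarrow> e y \<cdot>\<^bsub>C\<^esub> d x y = e x"
    then have "cocone J C E b e" by (auto simp: cocone_iff)
    then show "\<exists>!h. h \<in> hom C a b \<and> (\<forall>x\<in>S. h \<cdot>\<^bsub>C\<^esub> c x = e x)"
      using ac by (simp add: colimit_def J_def)
  qed
qed

lemma ex_coequalizer:
  fixes U :: "'k::ordinals itself"
  assumes coc: "cocomplete U C" and r: "r \<in> hom C a b" and s: "s \<in> hom C a b"
  obtains c e where "coequalizer C a b r s c e"
proof -
  \<comment> \<open>The walking parallel pair: \<open>Inl\<close> gives the identities of the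
    objects \<open>False\<close> and \<open>True\<close>, and the two elements \<open>Inr\<close>
    are the parallel arrows from \<open>False\<close> to \<open>True\<close>.\<close>
  define J :: "(bool, bool + bool) cat" where "J = \<lparr>Obj = UNIV, Arr = UNIV,
    Dom = (\<lambda>u. case u of Inl x \<Rightarrow> x | Inr _ \<Rightarrow> False),
    Cod = (\<lambda>u. case u of Inl x \<Rightarrow> x | Inr _ \<Rightarrow> True),
    Ide = Inl, Comp = (\<lambda>u v. case u of Inl _ \<Rightarrow> v | Inr _ \<Rightarrow> u)\<rparr>"
  define D where "D = \<lparr>on_obj = (\<lambda>x. if x then b else a),
    on_arr = (\<lambda>u. case u of Inl x \<Rightarrow> Ide C (if x then b else a) | Inr x \<Rightarrow> if x then r else s)\<rparr>"
  note ab = hom_obj[OF r]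
  have J_hom: "u \<in> hom J x y \<longleftrightarrow> (case u of Inl z \<Rightarrow> x = z \<and> y = z | Inr _ \<Rightarrow> \<not> x \<and> y)" for u x y
    by (auto simp: J_def hom_def split: sum.splits)
  have J_comp: "Comp J u v = (case u of Inl _ \<Rightarrow> v | Inr _ \<Rightarrow> u)" and J_ide: "Ide J = Inl" for u v
    by (simp_all add: J_def)
  have "category J"
    by unfold_locales (simp add: J_def, auto simp: J_hom J_comp J_ide split: sum.splits)
  moreover have "is_functor J C D"
    using ab r s ide_left ide_right ide_left[OF ide_hom]
    by unfold_locales (auto simp: J_hom J_comp J_ide D_def ide_hom split: sum.splits if_splits)
  moreover have "small U (Obj J)" "small U (Arr J)"
    by (simp_all add: small_finite)
  ultimately obtain c k where ck: "colimit J C D c k" using small_colimit[OF coc] by blast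
  have cocone_iff: "cocone J C D x h \<longleftrightarrow> x \<in> Obj C \<and> h False \<in> hom C a x \<and> h True \<in> hom C b x \<and>
      h True \<cdot>\<^bsub>C\<^esub> r = h False \<and> h True \<cdot>\<^bsub>C\<^esub> s = h False" for x h
  proof -
    \<comment> \<open>The middle conjunct comes from the identity arrows of \<open>J\<close>; it
      holds by the unit law and is dropped in the next step.\<close>
    have "cocone J C D x h \<longleftrightarrow> (x \<in> Obj C \<and> h False \<in> hom C a x \<and> h True \<in> hom C b x) \<and>
        (h True \<cdot>\<^bsub>C\<^esub> Ide C b = h True \<and> h False \<cdot>\<^bsub>C\<^esub> Ide C a = h False) \<and>
        (h True \<cdot>\<^bsub>C\<^esub> r = h False \<and> h True \<cdot>\<^bsub>C\<^esub> s = h False)"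
      unfolding cocone_def J_def D_def by (simp add: split_sum_all all_bool_eq conj_ac)
    also have "\<dots> \<longleftrightarrow> (x \<in> Obj C \<and> h False \<in> hom C a x \<and> h True \<in> hom C b x) \<and>
        (h True \<cdot>\<^bsub>C\<^esub> r = h False \<and> h True \<cdot>\<^bsub>C\<^esub> s = h False)"
      by (rule conj_cong[OF refl]) (simp add: ide_right[of _ a x] ide_right[of _ b x])
    finally show ?thesis by (simp only: conj_assoc)
  qed
  have k: "c \<in> Obj C" "k False \<in> hom C a c" "k True \<in> hom C b c"
    "k True \<cdot>\<^bsub>C\<^esub> r = k False" "k True \<cdot>\<^bsub>C\<^esub> s = k False"
    using ck unfolding colimit_def cocone_iff by simp_all
  have "coequalizer C a b r s c (k True)"
    unfolding coequalizer_def
  proof (intro conjI ballI impI)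
    fix d f assume d: "d \<in> Obj C" and f: "f \<in> hom C b d" and eq: "f \<cdot>\<^bsub>C\<^esub> r = f \<cdot>\<^bsub>C\<^esub> s"
    \<comment> \<open>The component of a cocone at the source is forced by the one at the target;
      the choice of \<open>s\<close> instead of \<open>r\<close> is immaterial by
      \<open>eq\<close>.\<close>
    define h where "h = (\<lambda>x. if x then f else f \<cdot>\<^bsub>C\<^esub> s)"
    have "cocone J C D d h"
      using d f eq comp_hom[OF s f] by (simp add: cocone_iff h_def)
    then have "\<exists>!u. u \<in> hom C c d \<and> (\<forall>i\<in>Obj J. u \<cdot>\<^bsub>C\<^esub> k i = h i)"
      using ck by (simp add: colimit_def)
    moreover have "u \<in> hom C c d \<and> (\<forall>i\<in>Obj J. u \<cdot>\<^bsub>C\<^esub> k i = h i) \<longleftrightarrow>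
        u \<in> hom C c d \<and> u \<cdot>\<^bsub>C\<^esub> k True = f" for u
      using comp_assoc[OF s k(3), of u d] k(5) by (auto simp: J_def h_def all_bool_eq)
    ultimately show "\<exists>!u. u \<in> hom C c d \<and> u \<cdot>\<^bsub>C\<^esub> k True = f"
      by simp
  qed (simp_all only: r s k)
  then show thesis by (rule that)
qed

end


section \<open>Free chains of term cones\<close>

locale endofunctor = category C + is_functor C C F
  for C :: "('o, 'm) cat" and F :: "('o, 'm) endo"
begin

text \<open>
  A cone \<open>(z, g, \<pi>)\<close> consists of \<open>g : A \<rightarrow> z\<close> and \<open>\<pi>\<^sub>k : F X\<^sub>k \<rightarrow> z\<close> for \<open>k < n\<close>. For the term chain,
  \<open>X\<^sub>k = F\<^sub>k A\<close> and the universal \<open>\<pi>\<^sub>k\<close> is \<open>w\<^sub>k\<^sub>+\<^sub>1\<^sub>,\<^sub>n \<circ> q\<^sub>k\<close>.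
\<close>

definition term_cone ::
    "'o \<Rightarrow> ('k::ordinals \<Rightarrow> 'o) \<Rightarrow> ('k \<Rightarrow> 'k \<Rightarrow> 'm) \<Rightarrow> 'k \<Rightarrow> 'o \<Rightarrow> 'm \<Rightarrow> ('k \<Rightarrow> 'm) \<Rightarrow> bool" where
  "term_cone A X w n z g \<pi> \<longleftrightarrow> z \<in> Obj C \<and> g \<in> hom C A z \<and>
     (\<forall>k<n. \<pi> k \<in> hom C (on_obj F (X k)) z) \<and>
     (\<forall>j k. j \<le> k \<and> k < n \<longrightarrow> \<pi> k \<cdot>\<^bsub>C\<^esub> on_arr F (w j k) = \<pi> j)"

definition free_cone ::
    "'o \<Rightarrow> ('k::ordinals \<Rightarrow> 'o) \<Rightarrow> ('k \<Rightarrow> 'k \<Rightarrow> 'm) \<Rightarrow> 'k \<Rightarrow> 'o \<Rightarrow> 'm \<Rightarrow> ('k \<Rightarrow> 'm) \<Rightarrow> bool" where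
  "free_cone A X w n x i p \<longleftrightarrow> term_cone A X w n x i p \<and>
     (\<forall>z g \<pi>. term_cone A X w n z g \<pi> \<longrightarrow>
        (\<exists>!h. h \<in> hom C x z \<and> h \<cdot>\<^bsub>C\<^esub> i = g \<and> (\<forall>k<n. h \<cdot>\<^bsub>C\<^esub> p k = \<pi> k)))"

lemma term_coneI:
  assumes "z \<in> Obj C" "g \<in> hom C A z" "\<And>k. k < n \<Longrightarrow> \<pi> k \<in> hom C (on_obj F (X k)) z"
    "\<And>j k. \<lbrakk>j \<le> k; k < n\<rbrakk> \<Longrightarrow> \<pi> k \<cdot>\<^bsub>C\<^esub> on_arr F (w j k) = \<pi> j"
  shows "term_cone A X w n z g \<pi>"
  using assms by (auto simp: term_cone_def)

lemma term_coneD: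
  assumes "term_cone A X w n z g \<pi>"
  shows "z \<in> Obj C" "g \<in> hom C A z" "\<And>k. k < n \<Longrightarrow> \<pi> k \<in> hom C (on_obj F (X k)) z"
    "\<And>j k. \<lbrakk>j \<le> k; k < n\<rbrakk> \<Longrightarrow> \<pi> k \<cdot>\<^bsub>C\<^esub> on_arr F (w j k) = \<pi> j"
  using assms by (auto simp: term_cone_def)

lemma term_cone_mono: "\<lbrakk>term_cone A X w n z g \<pi>; m \<le> n\<rbrakk> \<Longrightarrow> term_cone A X w m z g \<pi>"
  by (auto simp: term_cone_def)

lemma free_coneD:
  assumes "free_cone A X w n x i p" "term_cone A X w n z g \<pi>"
  shows "\<exists>!h. h \<in> hom C x z \<and> h \<cdot>\<^bsub>C\<^esub> i = g \<and> (\<forall>k<n. h \<cdot>\<^bsub>C\<^esub> p k = \<pi> k)"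
  using assms unfolding free_cone_def by blast

lemma term_cone_cong:
  assumes "\<And>k. k < n \<Longrightarrow> X k = X' k" "\<And>j k. \<lbrakk>j \<le> k; k < n\<rbrakk> \<Longrightarrow> w j k = w' j k"
  shows "term_cone A X w n = term_cone A X' w' n"
  using assms by (intro ext) (auto simp: term_cone_def)

text \<open>Freeness at stage \<open>n\<close> looks only at the stages strictly below
  \<open>n\<close>. This is what makes it usable as the condition of a well-founded
  recursion.\<close>

lemma free_cone_cong:
  assumes "\<And>k. k < n \<Longrightarrow> X k = X' k" "\<And>j k. \<lbrakk>j \<le> k; k < n\<rbrakk> \<Longrightarrow> w j k = w' j k"
  shows "free_cone A X w n = free_cone A X' w' n"
  using term_cone_cong[of n X X' w w' A, OF assms] by (intro ext) (simp add: free_cone_def)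

end

text \<open>The index set \<open>N\<close> is a variable so that the same facts apply to an initial
  segment during the recursion and to all ordinals afterwards. Universality is left out, since the
  targets of the maps constructed later are chains that may fail to be free.\<close>

locale chain = endofunctor C F for C :: "('o, 'm) cat" and F :: "('o, 'm) endo" +
  fixes N :: "'k::ordinals set" and A :: 'o and X :: "'k \<Rightarrow> 'o" and w :: "'k \<Rightarrow> 'k \<Rightarrow> 'm"
    and i :: "'k \<Rightarrow> 'm" and p :: "'k \<Rightarrow> 'k \<Rightarrow> 'm"
  assumes down: "\<lbrakk>m \<le> n; n \<in> N\<rbrakk> \<Longrightarrow> m \<in> N"
    and cone: "n \<in> N \<Longrightarrow> term_cone A X w n (X n) (i n) (p n)"
    and w_hom: "\<lbrakk>m \<le> n; n \<in> N\<rbrakk> \<Longrightarrow> w m n \<in> hom C (X m) (X n)"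
    and w_i: "\<lbrakk>m \<le> n; n \<in> N\<rbrakk> \<Longrightarrow> w m n \<cdot>\<^bsub>C\<^esub> i m = i n"
    and w_p: "\<lbrakk>k < m; m \<le> n; n \<in> N\<rbrakk> \<Longrightarrow> w m n \<cdot>\<^bsub>C\<^esub> p m k = p n k"
begin

lemma X_obj: "n \<in> N \<Longrightarrow> X n \<in> Obj C"
  using cone by (rule term_coneD)

lemma i_hom: "n \<in> N \<Longrightarrow> i n \<in> hom C A (X n)"
  using cone by (rule term_coneD)

lemma p_hom: "\<lbrakk>k < n; n \<in> N\<rbrakk> \<Longrightarrow> p n k \<in> hom C (on_obj F (X k)) (X n)"
  using cone by (rule term_coneD)

lemma p_w: "\<lbrakk>j \<le> k; k < n; n \<in> N\<rbrakk> \<Longrightarrow> p n k \<cdot>\<^bsub>C\<^esub> on_arr F (w j k) = p n j"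
  using cone by (blast dest: term_coneD(4))

lemma F_w_hom: "\<lbrakk>j \<le> k; k \<in> N\<rbrakk> \<Longrightarrow> on_arr F (w j k) \<in> hom C (on_obj F (X j)) (on_obj F (X k))"
  by (rule on_arr[OF w_hom])

lemma term_cone_comp:
  assumes n: "n \<in> N" and h: "h \<in> hom C (X n) z"
  shows "term_cone A X w n z (h \<cdot>\<^bsub>C\<^esub> i n) (\<lambda>k. h \<cdot>\<^bsub>C\<^esub> p n k)"
proof (rule term_coneI)
  show "z \<in> Obj C" using h by (rule hom_obj)
  show "h \<cdot>\<^bsub>C\<^esub> i n \<in> hom C A z" using i_hom[OF n] h by (rule comp_hom)
  show "h \<cdot>\<^bsub>C\<^esub> p n k \<in> hom C (on_obj F (X k)) z" if "k < n" for k
    using p_hom[OF that n] h by (rule comp_hom)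
  show "(h \<cdot>\<^bsub>C\<^esub> p n k) \<cdot>\<^bsub>C\<^esub> on_arr F (w j k) = h \<cdot>\<^bsub>C\<^esub> p n j" if "j \<le> k" "k < n" for j k
    using comp_assoc[OF F_w_hom[OF that(1)] p_hom[OF that(2) n] h] down[OF _ n] p_w[OF that n] that
    by simp
qed

end

locale free_chain = chain +
  assumes free: "n \<in> N \<Longrightarrow> free_cone A X w n (X n) (i n) (p n)"
begin

text \<open>Both arrows mediate to the cone obtained by composing the free cone with
  \<open>h'\<close>, and the mediating arrow is unique.\<close>

lemma free_ext:
  assumes "n \<in> N" "h \<in> hom C (X n) z" "h' \<in> hom C (X n) z"
    and "h \<cdot>\<^bsub>C\<^esub> i n = h' \<cdot>\<^bsub>C\<^esub> i n" "\<And>k. k < n \<Longrightarrow> h \<cdot>\<^bsub>C\<^esub> p n k = h' \<cdot>\<^bsub>C\<^esub> p n k"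
  shows "h = h'"
  using free_coneD[OF free[OF assms(1)] term_cone_comp[OF assms(1,3)]] assms by blast

lemma w_refl:
  assumes "n \<in> N" shows "w n n = Ide C (X n)"
proof (rule free_ext[OF assms w_hom[OF order_refl assms] ide_hom[OF X_obj[OF assms]]])
  show "w n n \<cdot>\<^bsub>C\<^esub> i n = Ide C (X n) \<cdot>\<^bsub>C\<^esub> i n"
    using w_i[OF order_refl assms] ide_left[OF i_hom[OF assms]] by simp
  show "w n n \<cdot>\<^bsub>C\<^esub> p n k = Ide C (X n) \<cdot>\<^bsub>C\<^esub> p n k" if "k < n" for k
    using w_p[OF that order_refl assms] ide_left[OF p_hom[OF that assms]] by simp
qed

text \<open>Functoriality of the links is a consequence of freeness at \<open>k\<close>: both sides
  send \<open>i k\<close> to \<open>i n\<close> and \<open>p k j\<close> to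
  \<open>p n j\<close>.\<close>

lemma w_trans:
  assumes "k \<le> m" "m \<le> n" "n \<in> N"
  shows "w m n \<cdot>\<^bsub>C\<^esub> w k m = w k n"
proof -
  have m: "m \<in> N" and k: "k \<in> N" using assms down by blast+
  have kn: "k \<le> n" using assms by simp
  note wk = w_hom[OF assms(1) m] and wm = w_hom[OF assms(2,3)]
  show ?thesis
  proof (rule free_ext[OF k comp_hom[OF wk wm] w_hom[OF kn assms(3)]])
    show "(w m n \<cdot>\<^bsub>C\<^esub> w k m) \<cdot>\<^bsub>C\<^esub> i k = w k n \<cdot>\<^bsub>C\<^esub> i k"
      using comp_assoc[OF i_hom[OF k] wk wm] assms kn m by (simp add: w_i)
    show "(w m n \<cdot>\<^bsub>C\<^esub> w k m) \<cdot>\<^bsub>C\<^esub> p k j = w k n \<cdot>\<^bsub>C\<^esub> p k j" if "j < k" for j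
      using comp_assoc[OF p_hom[OF that k] wk wm] assms kn m that by (simp add: w_p)
  qed
qed

end

section \<open>Existence of free cones and free chains\<close>

context endofunctor
begin

text \<open>A term cone is a cocone on the diagram of all \<open>F X_k\<close> with
  \<open>k < n\<close>, enlarged by \<open>A\<close> as an isolated object. Its colimit is the free
  cone.\<close>

lemma ex_free_cone:
  fixes U :: "'k::ordinals itself" and n :: 'k
  assumes coc: "cocomplete U C" and A: "A \<in> Obj C" and "free_chain C F {..<n} A X w i p"
  shows "\<exists>x j q. free_cone A X w n x j q"
proof -
  interpret free_chain C F "{..<n}" A X w i p by fact
  \<comment> \<open>\<open>None\<close> is the index of \<open>A\<close>; it is related only to
    itself, so \<open>A\<close> enters the colimit without compatibility conditions.\<close>
  define S where "S = insert None (Some ` {..<n})"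
  define R where "R x y \<longleftrightarrow> x = y \<or> (\<exists>a b. x = Some a \<and> y = Some b \<and> a \<le> b)" for x y :: "'k option"
  define D where "D = case_option A (\<lambda>k. on_obj F (X k))"
  define d where "d x y = (case x of None \<Rightarrow> Ide C A | Some a \<Rightarrow>
    (case y of None \<Rightarrow> Ide C A | Some b \<Rightarrow> on_arr F (w a b)))" for x y
  have S: "small U S" unfolding S_def by (intro small_insert small_image small_segment)
  have R_cases: "x = None \<and> y = None \<or> (\<exists>a b. x = Some a \<and> y = Some b \<and> a \<le> b)"
    if "R x y" for x y using that by (cases x) (auto simp: R_def)
  have F_refl: "on_arr F (w k k) = Ide C (on_obj F (X k))" if "k < n" for k
    using that X_obj on_ide w_refl by simp
  have F_trans: "on_arr F (w k l) \<cdot>\<^bsub>C\<^esub> on_arr F (w j k) = on_arr F (w j l)"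
    if "j \<le> k" "k \<le> l" "l < n" for j k l
    using that w_trans[of j k l] on_comp[OF w_hom w_hom, of j k l] by simp
  obtain x c where x: "x \<in> Obj C" and c: "\<And>s. s \<in> S \<Longrightarrow> c s \<in> hom C (D s) x"
    and cd: "\<And>s t. \<lbrakk>s \<in> S; t \<in> S; R s t\<rbrakk> \<Longrightarrow> c t \<cdot>\<^bsub>C\<^esub> d s t = c s"
    and univ: "\<And>b e. \<lbrakk>b \<in> Obj C; \<And>s. s \<in> S \<Longrightarrow> e s \<in> hom C (D s) b;
        \<And>s t. \<lbrakk>s \<in> S; t \<in> S; R s t\<rbrakk> \<Longrightarrow> e t \<cdot>\<^bsub>C\<^esub> d s t = e s\<rbrakk>
      \<Longrightarrow> \<exists>!h. h \<in> hom C x b \<and> (\<forall>s\<in>S. h \<cdot>\<^bsub>C\<^esub> c s = e s)"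
  proof (rule preorder_colimit[OF coc S, of R D d])
    show "R s s" for s by (simp add: R_def)
    show "R s u" if "R s t" "R t u" for s t u
      using R_cases[OF that(1)] R_cases[OF that(2)] by (auto simp: R_def)
    show "D s \<in> Obj C" if "s \<in> S" for s
      using that A X_obj on_obj by (auto simp: S_def D_def)
    show "d s t \<in> hom C (D s) (D t)" if "s \<in> S" "t \<in> S" "R s t" for s t
      using R_cases[OF that(3)] that(2) A by (auto simp: S_def D_def d_def ide_hom F_w_hom)
    show "d s s = Ide C (D s)" if "s \<in> S" for s
      using that F_refl by (auto simp: S_def D_def d_def)
    show "d t u \<cdot>\<^bsub>C\<^esub> d s t = d s u" if "s \<in> S" "t \<in> S" "u \<in> S" "R s t" "R t u" for s t u
      using R_cases[OF that(4)] R_cases[OF that(5)] that(3) ide_left[OF ide_hom[OF A]]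
      by (auto simp: S_def d_def F_trans)
  qed blast
  have "free_cone A X w n x (c None) (\<lambda>k. c (Some k))"
    unfolding free_cone_def
  proof (intro conjI allI impI)
    show "term_cone A X w n x (c None) (\<lambda>k. c (Some k))"
    proof (rule term_coneI[OF x])
      show "c None \<in> hom C A x" using c[of None] by (simp add: S_def D_def)
      show "c (Some k) \<in> hom C (on_obj F (X k)) x" if "k < n" for k
        using c[of "Some k"] that by (simp add: S_def D_def)
      show "c (Some k) \<cdot>\<^bsub>C\<^esub> on_arr F (w j k) = c (Some j)" if "j \<le> k" "k < n" for j k
        using cd[of "Some j" "Some k"] that by (simp add: S_def d_def R_def)
    qed
    fix z g \<pi> assume cone: "term_cone A X w n z g \<pi>"
    have "\<exists>!h. h \<in> hom C x z \<and> (\<forall>s\<in>S. h \<cdot>\<^bsub>C\<^esub> c s = case_option g \<pi> s)"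
    proof (rule univ)
      show "z \<in> Obj C" using cone by (rule term_coneD)
      show "case_option g \<pi> s \<in> hom C (D s) z" if "s \<in> S" for s
        using that term_coneD[OF cone] by (auto simp: S_def D_def)
      show "case_option g \<pi> t \<cdot>\<^bsub>C\<^esub> d s t = case_option g \<pi> s"
        if "s \<in> S" "t \<in> S" "R s t" for s t
        using R_cases[OF that(3)] that(2) term_coneD[OF cone] ide_right
        by (auto simp: S_def d_def)
    qed
    moreover have "(\<forall>s\<in>S. h \<cdot>\<^bsub>C\<^esub> c s = case_option g \<pi> s) \<longleftrightarrow>
        h \<cdot>\<^bsub>C\<^esub> c None = g \<and> (\<forall>k<n. h \<cdot>\<^bsub>C\<^esub> c (Some k) = \<pi> k)" for h
      by (auto simp: S_def)
    ultimately show "\<exists>!h. h \<in> hom C x z \<and> h \<cdot>\<^bsub>C\<^esub> c None = g \<and>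
        (\<forall>k<n. h \<cdot>\<^bsub>C\<^esub> c (Some k) = \<pi> k)"
      by simp
  qed
  then show ?thesis by blast
qed

text \<open>The recursion produces only the triples of vertex, arrow from \<open>A\<close> and
  arrows from \<open>F X_k\<close>. The links need no place in it, being determined by two such
  triples through freeness of the earlier one.\<close>

lemma ex_free_chain:
  fixes U :: "'k::ordinals itself"
  assumes coc: "cocomplete U C" and A: "A \<in> Obj C"
  obtains X and w :: "'k \<Rightarrow> 'k \<Rightarrow> 'm" and i p
  where "free_chain C F UNIV A X w i p" "X ord_zero = A" "i ord_zero = Ide C A"
proof -
  \<comment> \<open>The mediating arrow from the triple \<open>r\<close> at stage \<open>n\<close>
    to a later triple \<open>s\<close>.\<close>
  define lk :: "'k \<Rightarrow> 'o \<times> 'm \<times> ('k \<Rightarrow> 'm) \<Rightarrow> 'o \<times> 'm \<times> ('k \<Rightarrow> 'm) \<Rightarrow> 'm" where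
    "lk n r s = (THE u. u \<in> hom C (fst r) (fst s) \<and> u \<cdot>\<^bsub>C\<^esub> fst (snd r) = fst (snd s) \<and>
      (\<forall>k<n. u \<cdot>\<^bsub>C\<^esub> snd (snd r) k = snd (snd s) k))" for n r s
  \<comment> \<open>The clause at zero fixes the stage there on the nose and not merely up to
    isomorphism, because the term chain demands that its zeroth functor be the identity.\<close>
  define stage :: "('k \<Rightarrow> 'o \<times> 'm \<times> ('k \<Rightarrow> 'm)) \<Rightarrow> 'k \<Rightarrow> 'o \<times> 'm \<times> ('k \<Rightarrow> 'm) \<Rightarrow> bool" where
    "stage f n r \<longleftrightarrow>
      free_cone A (\<lambda>k. fst (f k)) (\<lambda>j k. lk j (f j) (f k)) n (fst r) (fst (snd r)) (snd (snd r)) \<and>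
      (n = ord_zero \<longrightarrow> fst r = A \<and> fst (snd r) = Ide C A)" for f n r
  \<comment> \<open>Stated for any downward closed \<open>N\<close>: inside the recursion it is
    applied to an initial segment, at the end to all ordinals.\<close>
  have chain: "free_chain C F N A (\<lambda>k. fst (f k)) (\<lambda>j k. lk j (f j) (f k))
      (\<lambda>k. fst (snd (f k))) (\<lambda>k. snd (snd (f k)))"
    if down: "\<And>m n. \<lbrakk>m \<le> n; n \<in> N\<rbrakk> \<Longrightarrow> m \<in> N" and st: "\<And>n. n \<in> N \<Longrightarrow> stage f n (f n)" for N f
  proof -
    let ?X = "\<lambda>k. fst (f k)" and ?w = "\<lambda>j k. lk j (f j) (f k)"
      and ?i = "\<lambda>k. fst (snd (f k))" and ?p = "\<lambda>k. snd (snd (f k))"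
    have free: "free_cone A ?X ?w n (?X n) (?i n) (?p n)" if "n \<in> N" for n
      using st[OF that] by (simp add: stage_def)
    then have cone: "term_cone A ?X ?w n (?X n) (?i n) (?p n)" if "n \<in> N" for n
      using that by (simp add: free_cone_def)
    \<comment> \<open>Cut down to the indices below \<open>m\<close>, the cone at stage
      \<open>n\<close> is a cone for stage \<open>m\<close>, so freeness at \<open>m\<close> yields
      the link with its equations.\<close>
    have link: "?w m n \<in> hom C (?X m) (?X n) \<and> ?w m n \<cdot>\<^bsub>C\<^esub> ?i m = ?i n \<and>
        (\<forall>k<m. ?w m n \<cdot>\<^bsub>C\<^esub> ?p m k = ?p n k)" if "m \<le> n" "n \<in> N" for m n
      unfolding lk_def
      by (rule theI'[OF free_coneD[OF free[OF down[OF that]] term_cone_mono[OF cone[OF that(2)] that(1)]]])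
    show ?thesis
      using down cone free link by unfold_locales blast+
  qed
  have "\<exists>f. \<forall>n. stage f n (f n)"
  proof (rule dependent_wellorder_choice)
    show "stage f n r = stage g n r" if "\<And>k. k < n \<Longrightarrow> f k = g k" for r f g n
      using free_cone_cong[of n "\<lambda>k. fst (f k)" "\<lambda>k. fst (g k)"
          "\<lambda>j k. lk j (f j) (f k)" "\<lambda>j k. lk j (g j) (g k)" A] that
      by (simp add: stage_def)
    show "\<exists>r. stage f n r" if "\<And>k. k < n \<Longrightarrow> stage f k (f k)" for n f
    proof (cases "n = ord_zero")
      case True
      \<comment> \<open>No index lies below zero, so a cone is just an arrow out of
        \<open>A\<close>, and \<open>A\<close> with its identity is initial. The family
        \<open>\<pi>\<close> is arbitrary.\<close>
      have "free_cone A (\<lambda>k. fst (f k)) (\<lambda>j k. lk j (f j) (f k)) n A (Ide C A) \<pi>" for \<pi>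
        using A ide_hom[OF A] ide_right by (auto simp: True free_cone_def term_cone_def)
      then have "stage f n (A, Ide C A, \<pi>)" for \<pi>
        by (simp add: stage_def)
      then show ?thesis by blast
    next
      case False
      have "free_chain C F {..<n} A (\<lambda>k. fst (f k)) (\<lambda>j k. lk j (f j) (f k))
        (\<lambda>k. fst (snd (f k))) (\<lambda>k. snd (snd (f k)))"
        using that by (intro chain) auto
      from ex_free_cone[OF coc A this] obtain x j q
        where "free_cone A (\<lambda>k. fst (f k)) (\<lambda>j k. lk j (f j) (f k)) n x j q" by blast
      with False have "stage f n (x, j, q)" by (simp add: stage_def)
      then show ?thesis by blast
    qed
  qed
  then obtain f where f: "\<And>n. stage f n (f n)" by blast
  show thesis
    by (rule that[OF chain[of UNIV f]]) (use f[of ord_zero] f in \<open>simp_all add: stage_def\<close>)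
qed

end


section \<open>Maps out of a free chain\<close>

text \<open>A free chain maps uniquely to every chain \<open>Y\<close> over the same
  \<open>A\<close> and \<open>F\<close>. With \<open>Y\<close> the free chain of another object this
  gives the action of the term functors on arrows; with \<open>Y\<close> constant at an algebra it
  gives term evaluation.\<close>

locale folding = free_chain C F UNIV A X w i p + Y: chain C F UNIV A Y v g \<pi>
  for C :: "('o, 'm) cat" and F :: "('o, 'm) endo" and A and X :: "'k::ordinals \<Rightarrow> 'o" and w i p
    and Y :: "'k \<Rightarrow> 'o" and v g \<pi>
begin

text \<open>The value \<open>r\<close> at \<open>n\<close> is kept apart from the family
  \<open>h\<close>, which is consulted only below \<open>n\<close>: the form required for choice
  along a well-order.\<close>

definition fold_at :: "('k \<Rightarrow> 'm) \<Rightarrow> 'k \<Rightarrow> 'm \<Rightarrow> bool" where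
  "fold_at h n r \<longleftrightarrow> r \<in> hom C (X n) (Y n) \<and> r \<cdot>\<^bsub>C\<^esub> i n = g n \<and>
     (\<forall>k<n. r \<cdot>\<^bsub>C\<^esub> p n k = \<pi> n k \<cdot>\<^bsub>C\<^esub> on_arr F (h k))"

lemma fold_atD:
  assumes "fold_at h n r"
  shows "r \<in> hom C (X n) (Y n)" "r \<cdot>\<^bsub>C\<^esub> i n = g n"
    "\<And>k. k < n \<Longrightarrow> r \<cdot>\<^bsub>C\<^esub> p n k = \<pi> n k \<cdot>\<^bsub>C\<^esub> on_arr F (h k)"
  using assms by (auto simp: fold_at_def)

text \<open>By freeness at \<open>m\<close> it suffices to compare both sides on \<open>i m\<close>
  and on each \<open>p m k\<close>. The hypothesis reaches only up to \<open>n\<close>, because the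
  lemma is applied in the middle of the recursion that constructs \<open>h\<close>.\<close>

lemma fold_natural:
  assumes fold: "\<And>k. k \<le> n \<Longrightarrow> fold_at h k (h k)" and mn: "m \<le> n"
  shows "h n \<cdot>\<^bsub>C\<^esub> w m n = v m n \<cdot>\<^bsub>C\<^esub> h m"
proof -
  note fm = fold_atD[OF fold[OF mn]] and fn = fold_atD[OF fold[OF order_refl]]
  note w = w_hom[OF mn UNIV_I] and v = Y.w_hom[OF mn UNIV_I]
  show ?thesis
  proof (rule free_ext[OF UNIV_I comp_hom[OF w fn(1)] comp_hom[OF fm(1) v]])
    show "(h n \<cdot>\<^bsub>C\<^esub> w m n) \<cdot>\<^bsub>C\<^esub> i m = (v m n \<cdot>\<^bsub>C\<^esub> h m) \<cdot>\<^bsub>C\<^esub> i m"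
      using comp_assoc[OF i_hom w fn(1)] comp_assoc[OF i_hom fm(1) v] mn
      by (simp add: w_i Y.w_i fm(2) fn(2))
    show "(h n \<cdot>\<^bsub>C\<^esub> w m n) \<cdot>\<^bsub>C\<^esub> p m k = (v m n \<cdot>\<^bsub>C\<^esub> h m) \<cdot>\<^bsub>C\<^esub> p m k" if k: "k < m" for k
    proof -
      have kn: "k < n" using k mn by simp
      note Fh = on_arr[OF fold_atD(1)[OF fold[OF less_imp_le[OF kn]]]]
      show ?thesis
        using comp_assoc[OF p_hom[OF k UNIV_I] w fn(1)] comp_assoc[OF p_hom[OF k UNIV_I] fm(1) v]
          comp_assoc[OF Fh Y.p_hom[OF k UNIV_I] v] k kn mn
        by (simp add: w_p Y.w_p fm(3) fn(3))
    qed
  qed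
qed

lemma ex_fold: "\<exists>h. \<forall>n. fold_at h n (h n)"
proof (rule dependent_wellorder_choice)
  show "fold_at h n r = fold_at h' n r" if "\<And>k. k < n \<Longrightarrow> h k = h' k" for r h h' n
    using that by (simp add: fold_at_def)
  show "\<exists>r. fold_at h n r" if h: "\<And>k. k < n \<Longrightarrow> fold_at h k (h k)" for h n
  proof -
    note Fh = on_arr[OF fold_atD(1)[OF h]]
    \<comment> \<open>The vertex of \<open>Y\<close> at \<open>n\<close> becomes a cone under the
      earlier stages of \<open>X\<close>. Its compatibility is that of \<open>\<pi>\<close>, moved
      across by naturality of the part of \<open>h\<close> already built.\<close>
    have "term_cone A X w n (Y n) (g n) (\<lambda>k. \<pi> n k \<cdot>\<^bsub>C\<^esub> on_arr F (h k))"
    proof (rule term_coneI)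
      show "Y n \<in> Obj C" "g n \<in> hom C A (Y n)" by (simp_all add: Y.X_obj Y.i_hom)
      show "\<pi> n k \<cdot>\<^bsub>C\<^esub> on_arr F (h k) \<in> hom C (on_obj F (X k)) (Y n)" if "k < n" for k
        using Fh[OF that] Y.p_hom[OF that UNIV_I] by (rule comp_hom)
      show "(\<pi> n k \<cdot>\<^bsub>C\<^esub> on_arr F (h k)) \<cdot>\<^bsub>C\<^esub> on_arr F (w j k) = \<pi> n j \<cdot>\<^bsub>C\<^esub> on_arr F (h j)"
        if jk: "j \<le> k" and k: "k < n" for j k
      proof -
        have j: "j < n" using jk k by simp
        have "h k \<cdot>\<^bsub>C\<^esub> w j k = v j k \<cdot>\<^bsub>C\<^esub> h j"
          using jk k h by (intro fold_natural) auto
        then have "on_arr F (h k) \<cdot>\<^bsub>C\<^esub> on_arr F (w j k) = on_arr F (v j k) \<cdot>\<^bsub>C\<^esub> on_arr F (h j)"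
          using on_comp[OF w_hom[OF jk UNIV_I] fold_atD(1)[OF h[OF k]]]
            on_comp[OF fold_atD(1)[OF h[OF j]] Y.w_hom[OF jk UNIV_I]] by simp
        then show ?thesis
          using comp_assoc[OF F_w_hom[OF jk UNIV_I] Fh[OF k] Y.p_hom[OF k UNIV_I]]
            comp_assoc[OF Fh[OF j] Y.F_w_hom[OF jk UNIV_I] Y.p_hom[OF k UNIV_I]] Y.p_w[OF jk k UNIV_I]
          by simp
      qed
    qed
    from free_coneD[OF free[OF UNIV_I] this] show ?thesis
      unfolding fold_at_def by blast
  qed
qed

lemma fold_unique:
  assumes "\<And>n. fold_at h n (h n)" "\<And>n. fold_at h' n (h' n)"
  shows "h n = h' n"
proof (induction n rule: less_induct)
  case (less n)
  show ?case
    by (rule free_ext[OF UNIV_I fold_atD(1)[OF assms(1)] fold_atD(1)[OF assms(2)]])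
      (simp_all add: fold_atD(2,3)[OF assms(1)] fold_atD(2,3)[OF assms(2)] less)
qed

end

text \<open>The two descriptions of a mediating arrow compared below are equivalent only for arrows
  of the right type, hence the restriction to \<open>H\<close>.\<close>

lemma ex1_cong_on:
  assumes "\<exists>!h. h \<in> H \<and> P h" and "\<And>h. h \<in> H \<Longrightarrow> P h \<longleftrightarrow> Q h"
  shows "\<exists>!h. h \<in> H \<and> Q h"
proof -
  have "h \<in> H \<and> P h \<longleftrightarrow> h \<in> H \<and> Q h" for h using assms(2) by blast
  with assms(1) show ?thesis by simp
qed

section \<open>Successor and limit stages of a free chain\<close>

context free_chain
begin

text \<open>Below a successor there is a largest index \<open>n\<close>, and compatibility
  determines all arrows of a cone from the one at \<open>n\<close>. So a cone is a pair of arrows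
  from \<open>F X_n\<close> and from \<open>A\<close>.\<close>

lemma coproduct_suc:
  assumes N: "ord_suc n \<in> N" and A: "A \<in> Obj C"
  shows "coproduct C (on_obj F (X n)) A (X (ord_suc n)) (p (ord_suc n) n) (i (ord_suc n))"
  unfolding coproduct_def
proof (intro conjI ballI)
  show "X (ord_suc n) \<in> Obj C" "p (ord_suc n) n \<in> hom C (on_obj F (X n)) (X (ord_suc n))"
    "i (ord_suc n) \<in> hom C A (X (ord_suc n))"
    using N by (simp_all add: X_obj p_hom i_hom)
  fix z f g assume z: "z \<in> Obj C" and f: "f \<in> hom C (on_obj F (X n)) z" and g: "g \<in> hom C A z"
  have n: "n \<in> N" using down[OF _ N, of n] by (simp add: less_imp_le)
  define \<pi> where "\<pi> k = f \<cdot>\<^bsub>C\<^esub> on_arr F (w k n)" for k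
  have "term_cone A X w (ord_suc n) z g \<pi>"
  proof (rule term_coneI[OF z g])
    show "\<pi> k \<in> hom C (on_obj F (X k)) z" if "k < ord_suc n" for k
      using comp_hom[OF F_w_hom f] that n by (simp add: \<pi>_def less_ord_suc_iff)
    show "\<pi> k \<cdot>\<^bsub>C\<^esub> on_arr F (w j k) = \<pi> j" if "j \<le> k" "k < ord_suc n" for j k
    proof -
      have kn: "k \<le> n" using that by (simp add: less_ord_suc_iff)
      note k = down[OF kn n]
      show ?thesis
        using comp_assoc[OF F_w_hom[OF that(1) k] F_w_hom[OF kn n] f]
          on_comp[OF w_hom[OF that(1) k] w_hom[OF kn n]] w_trans[OF that(1) kn n]
        by (simp add: \<pi>_def)
    qed
  qed
  note univ = free_coneD[OF free[OF N] this]
  have eq: "(\<forall>k<(ord_suc n). h \<cdot>\<^bsub>C\<^esub> p (ord_suc n) k = \<pi> k) \<longleftrightarrow> h \<cdot>\<^bsub>C\<^esub> p (ord_suc n) n = f"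
    if h: "h \<in> hom C (X (ord_suc n)) z" for h
  proof
    have "\<pi> n = f" using ide_right[OF f] on_ide[OF X_obj[OF n]] by (simp add: \<pi>_def w_refl[OF n])
    then show "h \<cdot>\<^bsub>C\<^esub> p (ord_suc n) n = f" if "\<forall>k<(ord_suc n). h \<cdot>\<^bsub>C\<^esub> p (ord_suc n) k = \<pi> k"
      using that by simp
    show "\<forall>k<(ord_suc n). h \<cdot>\<^bsub>C\<^esub> p (ord_suc n) k = \<pi> k" if "h \<cdot>\<^bsub>C\<^esub> p (ord_suc n) n = f"
    proof (intro allI impI)
      fix k assume "k < ord_suc n"
      then have k: "k \<le> n" by (simp add: less_ord_suc_iff)
      show "h \<cdot>\<^bsub>C\<^esub> p (ord_suc n) k = \<pi> k"
        using comp_assoc[OF F_w_hom[OF k n] p_hom[OF less_ord_suc N] h] p_w[OF k less_ord_suc N] that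
        by (simp add: \<pi>_def)
    qed
  qed
  show "\<exists>!h. h \<in> hom C (X (ord_suc n)) z \<and>
      h \<cdot>\<^bsub>C\<^esub> p (ord_suc n) n = f \<and> h \<cdot>\<^bsub>C\<^esub> i (ord_suc n) = g"
    by (rule ex1_cong_on[OF univ]) (simp add: eq conj_commute)
qed

text \<open>At a limit, cocones on the earlier stages and term cones are the same thing: a cocone
  restricts along the \<open>i\<close> and \<open>p\<close> of these stages, and by their freeness
  it is recovered from the restrictions.\<close>

lemma colimit_below:
  assumes N: "n \<in> N" and limit: "ord_limit n"
  shows "colimit (below n) C \<lparr>on_obj = X, on_arr = (\<lambda>(j, k). w j k)\<rparr> (X n) (\<lambda>m. w m n)"
proof -
  let ?D = "\<lparr>on_obj = X, on_arr = (\<lambda>(j, k). w j k)\<rparr>"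
  have mN: "m \<in> N" if "m < n" for m using that down[OF _ N] by simp
  note zero = ord_limit_zero[OF limit] and suc = ord_limit_suc[OF limit]
  have cocone_iff: "cocone (below n) C ?D z d \<longleftrightarrow> z \<in> Obj C \<and>
      (\<forall>m<n. d m \<in> hom C (X m) z) \<and> (\<forall>j k. j \<le> k \<and> k < n \<longrightarrow> d k \<cdot>\<^bsub>C\<^esub> w j k = d j)" for z d
    by (auto simp: cocone_def below_def)
  show ?thesis
    unfolding colimit_def
  proof (intro conjI allI impI)
    show "cocone (below n) C ?D (X n) (\<lambda>m. w m n)"
      using N by (auto simp: cocone_iff X_obj w_hom w_trans)
    fix z d assume "cocone (below n) C ?D z d"
    then have z: "z \<in> Obj C" and d: "\<And>m. m < n \<Longrightarrow> d m \<in> hom C (X m) z"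
      and dw: "\<And>j k. \<lbrakk>j \<le> k; k < n\<rbrakk> \<Longrightarrow> d k \<cdot>\<^bsub>C\<^esub> w j k = d j" by (auto simp: cocone_iff)
    define g where "g = d ord_zero \<cdot>\<^bsub>C\<^esub> i ord_zero"
    \<comment> \<open>The arrow out of \<open>F X_k\<close> first appears at stage
      \<open>ord_suc k\<close>, which is still below \<open>n\<close> since \<open>n\<close> is a
      limit.\<close>
    define \<pi> where "\<pi> k = d (ord_suc k) \<cdot>\<^bsub>C\<^esub> p (ord_suc k) k" for k
    have d_i: "d m \<cdot>\<^bsub>C\<^esub> i m = g" if "m < n" for m
      using comp_assoc[OF i_hom[OF mN[OF zero]] w_hom[OF ord_zero_le mN[OF that]] d[OF that]]
        w_i[OF ord_zero_le mN[OF that]] dw[OF ord_zero_le that] by (simp add: g_def)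
    have d_p: "d m \<cdot>\<^bsub>C\<^esub> p m k = \<pi> k" if k: "k < m" and m: "m < n" for k m
    proof -
      have s: "ord_suc k \<le> m" using k by (simp add: ord_suc_le_iff)
      have sN: "ord_suc k \<in> N" using s m mN[of "ord_suc k"] by simp
      show ?thesis
        using comp_assoc[OF p_hom[OF less_ord_suc sN] w_hom[OF s mN[OF m]] d[OF m]]
          w_p[OF less_ord_suc s mN[OF m]] dw[OF s m] by (simp add: \<pi>_def)
    qed
    have "term_cone A X w n z g \<pi>"
    proof (rule term_coneI[OF z])
      show "g \<in> hom C A z" unfolding g_def using i_hom[OF mN[OF zero]] d[OF zero] by (rule comp_hom)
      show "\<pi> k \<in> hom C (on_obj F (X k)) z" if "k < n" for k
        unfolding \<pi>_def using p_hom[OF less_ord_suc mN[OF suc[OF that]]] d[OF suc[OF that]]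
        by (rule comp_hom)
      show "\<pi> k \<cdot>\<^bsub>C\<^esub> on_arr F (w j k) = \<pi> j" if jk: "j \<le> k" and k: "k < n" for j k
      proof -
        have "\<pi> k \<cdot>\<^bsub>C\<^esub> on_arr F (w j k) = d (ord_suc k) \<cdot>\<^bsub>C\<^esub> p (ord_suc k) j"
          using comp_assoc[OF F_w_hom[OF jk mN[OF k]] p_hom[OF less_ord_suc mN[OF suc[OF k]]]
              d[OF suc[OF k]]] p_w[OF jk less_ord_suc mN[OF suc[OF k]]]
          by (simp add: \<pi>_def)
        also have "\<dots> = \<pi> j" using jk suc[OF k] by (simp add: d_p less_ord_suc_iff)
        finally show ?thesis .
      qed
    qed
    note univ = free_coneD[OF free[OF N] this]
    have eq: "(\<forall>m\<in>Obj (below n). h \<cdot>\<^bsub>C\<^esub> w m n = d m) \<longleftrightarrow>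
        h \<cdot>\<^bsub>C\<^esub> i n = g \<and> (\<forall>k<n. h \<cdot>\<^bsub>C\<^esub> p n k = \<pi> k)" (is "?L \<longleftrightarrow> ?R")
      if h: "h \<in> hom C (X n) z" for h
    proof
      assume ?L
      then have L: "h \<cdot>\<^bsub>C\<^esub> w m n = d m" if "m < n" for m using that by (simp add: below_def)
      show ?R
      proof (intro conjI allI impI)
        show "h \<cdot>\<^bsub>C\<^esub> i n = g"
          using comp_assoc[OF i_hom[OF mN[OF zero]] w_hom[OF ord_zero_le N] h]
            w_i[OF ord_zero_le N] L[OF zero] by (simp add: g_def)
        show "h \<cdot>\<^bsub>C\<^esub> p n k = \<pi> k" if "k < n" for k
          using comp_assoc[OF p_hom[OF less_ord_suc mN[OF suc[OF that]]]
              w_hom[OF less_imp_le[OF suc[OF that]] N] h]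
            w_p[OF less_ord_suc less_imp_le[OF suc[OF that]] N] L[OF suc[OF that]]
          by (simp add: \<pi>_def)
      qed
    next
      assume R: ?R
      have "h \<cdot>\<^bsub>C\<^esub> w m n = d m" if m: "m < n" for m
      \<comment> \<open>Freeness is used here at the earlier stage \<open>m\<close>, where
        \<open>d m\<close> and the restriction of \<open>h\<close> induce the same cone.\<close>
      proof (rule free_ext[OF mN[OF m] comp_hom[OF w_hom[OF less_imp_le[OF m] N] h] d[OF m]])
        show "(h \<cdot>\<^bsub>C\<^esub> w m n) \<cdot>\<^bsub>C\<^esub> i m = d m \<cdot>\<^bsub>C\<^esub> i m"
          using comp_assoc[OF i_hom[OF mN[OF m]] w_hom[OF less_imp_le[OF m] N] h]
            w_i[OF less_imp_le[OF m] N] R by (simp add: d_i m)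
        show "(h \<cdot>\<^bsub>C\<^esub> w m n) \<cdot>\<^bsub>C\<^esub> p m k = d m \<cdot>\<^bsub>C\<^esub> p m k" if k: "k < m" for k
          using comp_assoc[OF p_hom[OF k mN[OF m]] w_hom[OF less_imp_le[OF m] N] h]
            w_p[OF k less_imp_le[OF m] N] R m k by (simp add: d_p)
      qed
      then show ?L by (simp add: below_def)
    qed
    show "\<exists>!h. h \<in> hom C (X n) z \<and> (\<forall>m\<in>Obj (below n). h \<cdot>\<^bsub>C\<^esub> w m n = d m)"
      by (rule ex1_cong_on[OF univ]) (simp only: eq)
  qed
qed

end


section \<open>The term functors\<close>

context endofunctor
begin

text \<open>A free chain is chosen over each object. An arrow acts by the unique map between the
  chains of its domain and codomain, and this uniqueness yields functoriality.\<close>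

lemma ex_term_chain:
  fixes U :: "'k::ordinals itself"
  assumes coc: "cocomplete U C"
  shows "\<exists>T :: ('k, 'o, 'm) term_chain. is_term_chain C F T"
proof -
  have "\<forall>A\<in>Obj C. \<exists>X (w :: 'k \<Rightarrow> 'k \<Rightarrow> 'm) i p.
      free_chain C F UNIV A X w i p \<and> X ord_zero = A \<and> i ord_zero = Ide C A"
    by (intro ballI, rule ex_free_chain[OF coc]) blast+
  then have "\<exists>X (w :: 'o \<Rightarrow> 'k \<Rightarrow> 'k \<Rightarrow> 'm) i p. \<forall>A\<in>Obj C.
      free_chain C F UNIV A (X A) (w A) (i A) (p A) \<and> X A ord_zero = A \<and> i A ord_zero = Ide C A"
    unfolding bchoice_iff .
  then obtain X and w :: "'o \<Rightarrow> 'k \<Rightarrow> 'k \<Rightarrow> 'm" and i p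
    where chains: "\<forall>A\<in>Obj C. free_chain C F UNIV A (X A) (w A) (i A) (p A) \<and>
      X A ord_zero = A \<and> i A ord_zero = Ide C A"
    by (elim exE)
  then have chain: "free_chain C F UNIV A (X A) (w A) (i A) (p A)"
    and X_zero: "X A ord_zero = A" and i_zero: "i A ord_zero = Ide C A" if "A \<in> Obj C" for A
    using that by simp_all
  define lift where "lift A B f h \<longleftrightarrow> (\<forall>n. h n \<in> hom C (X A n) (X B n) \<and>
      h n \<cdot>\<^bsub>C\<^esub> i A n = i B n \<cdot>\<^bsub>C\<^esub> f \<and>
      (\<forall>k<n. h n \<cdot>\<^bsub>C\<^esub> p A n k = p B n k \<cdot>\<^bsub>C\<^esub> on_arr F (h k)))" for A B f h
  have liftD: "h n \<in> hom C (X A n) (X B n)" "h n \<cdot>\<^bsub>C\<^esub> i A n = i B n \<cdot>\<^bsub>C\<^esub> f"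
    "k < n \<Longrightarrow> h n \<cdot>\<^bsub>C\<^esub> p A n k = p B n k \<cdot>\<^bsub>C\<^esub> on_arr F (h k)" if "lift A B f h" for A B f h n k
    using that by (simp_all add: lift_def)
  have lift: "(\<exists>h. lift A B f h) \<and>
      (\<forall>h h' n. lift A B f h \<longrightarrow> lift A B f h' \<longrightarrow> h n = h' n) \<and>
      (\<forall>h m n. lift A B f h \<longrightarrow> m \<le> n \<longrightarrow> h n \<cdot>\<^bsub>C\<^esub> w A m n = w B m n \<cdot>\<^bsub>C\<^esub> h m)"
    if f: "f \<in> hom C A B" for A B f
  proof -
    interpret A: free_chain C F UNIV A "X A" "w A" "i A" "p A" by (rule chain[OF hom_obj(1)[OF f]])
    interpret B: free_chain C F UNIV B "X B" "w B" "i B" "p B" by (rule chain[OF hom_obj(2)[OF f]])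
    \<comment> \<open>The chain of \<open>B\<close> becomes a chain over \<open>A\<close> by
      precomposing its arrows from \<open>B\<close> with \<open>f\<close>; folding into it gives
      existence, uniqueness and naturality of lifts at once.\<close>
    interpret folding C F A "X A" "w A" "i A" "p A" "X B" "w B" "\<lambda>n. i B n \<cdot>\<^bsub>C\<^esub> f" "p B"
    proof
      show "term_cone A (X B) (w B) n (X B n) (i B n \<cdot>\<^bsub>C\<^esub> f) (p B n)" for n
        using B.cone[OF UNIV_I, of n] comp_hom[OF f B.i_hom[OF UNIV_I]] by (simp add: term_cone_def)
      show "w B m n \<cdot>\<^bsub>C\<^esub> (i B m \<cdot>\<^bsub>C\<^esub> f) = i B n \<cdot>\<^bsub>C\<^esub> f" if "m \<le> n" for m n
        using comp_assoc[OF f B.i_hom[OF UNIV_I] B.w_hom[OF that UNIV_I]] B.w_i[OF that UNIV_I] by simp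
    qed (simp_all add: B.w_hom B.w_p)
    have eq: "lift A B f h \<longleftrightarrow> (\<forall>n. fold_at h n (h n))" for h
      by (simp add: lift_def fold_at_def)
    show ?thesis
      unfolding eq using ex_fold by (intro conjI allI impI fold_unique fold_natural) simp_all
  qed
  \<comment> \<open>An endofunctor acts on bare arrows, so the two objects are read off from
    \<open>f\<close>.\<close>
  define H where "H f = (SOME h. lift (Dom C f) (Cod C f) f h)" for f
  have H: "lift A B f (H f)" if "f \<in> hom C A B" for A B f
    using someI_ex[of "lift A B f"] lift[OF that] homD[OF that] by (simp add: H_def)
  have H_eq: "H f n = h n" if "f \<in> hom C A B" "lift A B f h" for A B f h n
    using lift[OF that(1)] H[OF that(1)] that(2) by blast
  have H_w: "H f n \<cdot>\<^bsub>C\<^esub> w A m n = w B m n \<cdot>\<^bsub>C\<^esub> H f m" if "f \<in> hom C A B" "m \<le> n" for A B f m n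
    using lift[OF that(1)] H[OF that(1)] that(2) by blast
  \<comment> \<open>The injection \<open>qinj\<close> at \<open>n\<close> is the top arrow of the
    cone at \<open>ord_suc n\<close>; the links are those of the chosen chains.\<close>
  define T where "T = \<lparr>trm = (\<lambda>n. \<lparr>on_obj = (\<lambda>A. X A n), on_arr = (\<lambda>f. H f n)\<rparr>),
    lnk = (\<lambda>m n A. w A m n), qinj = (\<lambda>n A. p A (ord_suc n) n)\<rparr>"
  have T_simps: "on_obj (trm T n) A = X A n" "on_arr (trm T n) f = H f n" "lnk T m n A = w A m n"
    "qinj T n A = p A (ord_suc n) n" for m n A f by (simp_all add: T_def)
  \<comment> \<open>Since \<open>i A ord_zero\<close> is an identity, the law \<open>w_i\<close>
    identifies the links out of zero with the arrows from \<open>A\<close>. This supplies the second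
    coproduct injection.\<close>
  have w_zero: "w A ord_zero n = i A n" if "A \<in> Obj C" for A n
  proof -
    interpret A: free_chain C F UNIV A "X A" "w A" "i A" "p A" by (rule chain[OF that])
    show ?thesis
      using A.w_i[OF ord_zero_le UNIV_I, of n] ide_right A.w_hom[OF ord_zero_le UNIV_I, of n]
        i_zero[OF that] X_zero[OF that] by simp
  qed
  have func: "is_functor C C (trm T n)" for n
  proof
    show "on_obj (trm T n) A \<in> Obj C" if "A \<in> Obj C" for A
    proof -
      interpret A: free_chain C F UNIV A "X A" "w A" "i A" "p A" by (rule chain[OF that])
      show ?thesis by (simp add: T_simps A.X_obj)
    qed
    show "on_arr (trm T n) f \<in> hom C (on_obj (trm T n) A) (on_obj (trm T n) B)"
      if "f \<in> hom C A B" for f A B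
      using liftD(1)[OF H[OF that]] by (simp add: T_simps)
    show "on_arr (trm T n) (Ide C A) = Ide C (on_obj (trm T n) A)" if A: "A \<in> Obj C" for A
    proof -
      interpret A: free_chain C F UNIV A "X A" "w A" "i A" "p A" by (rule chain[OF A])
      have "lift A A (Ide C A) (\<lambda>n. Ide C (X A n))"
        using ide_right[OF A.i_hom[OF UNIV_I]] ide_left[OF A.i_hom[OF UNIV_I]]
          ide_right[OF A.p_hom[OF _ UNIV_I]] ide_left[OF A.p_hom[OF _ UNIV_I]]
        by (simp add: lift_def ide_hom A.X_obj on_ide)
      from H_eq[OF ide_hom[OF A] this] show ?thesis by (simp add: T_simps)
    qed
    show "on_arr (trm T n) (g \<cdot>\<^bsub>C\<^esub> f) = on_arr (trm T n) g \<cdot>\<^bsub>C\<^esub> on_arr (trm T n) f"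
      if f: "f \<in> hom C A B" and g: "g \<in> hom C B D" for f g A B D
    proof -
      interpret A: free_chain C F UNIV A "X A" "w A" "i A" "p A" by (rule chain[OF hom_obj(1)[OF f]])
      interpret B: free_chain C F UNIV B "X B" "w B" "i B" "p B" by (rule chain[OF hom_obj(2)[OF f]])
      interpret D: free_chain C F UNIV D "X D" "w D" "i D" "p D" by (rule chain[OF hom_obj(2)[OF g]])
      note Hf = liftD[OF H[OF f]] and Hg = liftD[OF H[OF g]]
      have "lift A D (g \<cdot>\<^bsub>C\<^esub> f) (\<lambda>n. H g n \<cdot>\<^bsub>C\<^esub> H f n)"
        unfolding lift_def
      proof (intro allI conjI impI)
        show "H g n \<cdot>\<^bsub>C\<^esub> H f n \<in> hom C (X A n) (X D n)" for n
          using Hf(1) Hg(1) by (rule comp_hom)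
        show "(H g n \<cdot>\<^bsub>C\<^esub> H f n) \<cdot>\<^bsub>C\<^esub> i A n = i D n \<cdot>\<^bsub>C\<^esub> (g \<cdot>\<^bsub>C\<^esub> f)" for n
          using comp_assoc[OF A.i_hom[OF UNIV_I] Hf(1) Hg(1)] comp_assoc[OF f B.i_hom[OF UNIV_I] Hg(1)]
            comp_assoc[OF f g D.i_hom[OF UNIV_I]] by (simp add: Hf(2) Hg(2))
        show "(H g n \<cdot>\<^bsub>C\<^esub> H f n) \<cdot>\<^bsub>C\<^esub> p A n k = p D n k \<cdot>\<^bsub>C\<^esub> on_arr F (H g k \<cdot>\<^bsub>C\<^esub> H f k)"
          if k: "k < n" for n k
          using comp_assoc[OF A.p_hom[OF k UNIV_I] Hf(1) Hg(1)]
            comp_assoc[OF on_arr[OF Hf(1)] B.p_hom[OF k UNIV_I] Hg(1)]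
            comp_assoc[OF on_arr[OF Hf(1)] on_arr[OF Hg(1)] D.p_hom[OF k UNIV_I]]
            on_comp[OF Hf(1) Hg(1)] k
          by (simp add: Hf(3) Hg(3))
      qed
      from H_eq[OF comp_hom[OF f g] this] show ?thesis by (simp add: T_simps)
    qed
  qed
  have link: "nat_trans C C (trm T m) (trm T n) (lnk T m n)" if "m \<le> n" for m n
    unfolding nat_trans_def T_simps
  proof (intro conjI ballI)
    show "w A m n \<in> hom C (X A m) (X A n)" if "A \<in> Obj C" for A
    proof -
      interpret A: free_chain C F UNIV A "X A" "w A" "i A" "p A" by (rule chain[OF that])
      show ?thesis using \<open>m \<le> n\<close> by (simp add: A.w_hom)
    qed
    show "w B m n \<cdot>\<^bsub>C\<^esub> H f m = H f n \<cdot>\<^bsub>C\<^esub> w A m n" if "f \<in> hom C A B" for A B f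
      using H_w[OF that \<open>m \<le> n\<close>] by simp
  qed
  have inj: "nat_trans C C (comp_functor F (trm T n)) (trm T (ord_suc n)) (qinj T n)" for n
    unfolding nat_trans_def comp_functor_def funct.simps comp_apply T_simps
  proof (intro conjI ballI)
    show "p A (ord_suc n) n \<in> hom C (on_obj F (X A n)) (X A (ord_suc n))" if "A \<in> Obj C" for A
    proof -
      interpret A: free_chain C F UNIV A "X A" "w A" "i A" "p A" by (rule chain[OF that])
      show ?thesis by (simp add: A.p_hom)
    qed
    show "p B (ord_suc n) n \<cdot>\<^bsub>C\<^esub> on_arr F (H f n) = H f (ord_suc n) \<cdot>\<^bsub>C\<^esub> p A (ord_suc n) n"
      if "f \<in> hom C A B" for A B f
      using liftD(3)[OF H[OF that] less_ord_suc] by simp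
  qed
  have zero: "on_arr (trm T ord_zero) f = f" if "f \<in> Arr C" for f
  proof -
    note f = arr_hom[OF that]
    \<comment> \<open>At zero both arrows \<open>i\<close> are identities, so the lifting equation
      reads \<open>H f ord_zero = f\<close>.\<close>
    note h = liftD[OF H[OF f], of ord_zero]
    show ?thesis
      using h(1,2) hom_obj[OF f] ide_left[OF f] ide_right[of "H f ord_zero"]
      by (simp add: T_simps X_zero i_zero)
  qed
  have pointwise: "lnk T n n A = Ide C (on_obj (trm T n) A) \<and>
      (k \<le> m \<and> m \<le> n \<longrightarrow> lnk T m n A \<cdot>\<^bsub>C\<^esub> lnk T k m A = lnk T k n A) \<and>
      on_obj (trm T ord_zero) A = A \<and>
      coproduct C (on_obj F (on_obj (trm T n) A)) A (on_obj (trm T (ord_suc n)) A)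
        (qinj T n A) (lnk T ord_zero (ord_suc n) A) \<and>
      (m \<le> n \<longrightarrow> lnk T (ord_suc m) (ord_suc n) A \<cdot>\<^bsub>C\<^esub> qinj T m A
          = qinj T n A \<cdot>\<^bsub>C\<^esub> on_arr F (lnk T m n A)) \<and>
      (ord_limit n \<longrightarrow> colimit (below n) C
          \<lparr>on_obj = \<lambda>m. on_obj (trm T m) A, on_arr = \<lambda>(i, j). lnk T i j A\<rparr>
          (on_obj (trm T n) A) (\<lambda>m. lnk T m n A))" if A: "A \<in> Obj C" for A k m n
  proof -
    interpret A: free_chain C F UNIV A "X A" "w A" "i A" "p A" by (rule chain[OF A])
    show ?thesis
      unfolding T_simps X_zero[OF A] w_zero[OF A]
    proof (intro conjI impI refl)
      show "w A n n = Ide C (X A n)" by (rule A.w_refl[OF UNIV_I])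
      show "w A m n \<cdot>\<^bsub>C\<^esub> w A k m = w A k n" if "k \<le> m \<and> m \<le> n"
        using that by (simp add: A.w_trans)
      show "coproduct C (on_obj F (X A n)) A (X A (ord_suc n)) (p A (ord_suc n) n) (i A (ord_suc n))"
        by (rule A.coproduct_suc[OF UNIV_I A])
      show "w A (ord_suc m) (ord_suc n) \<cdot>\<^bsub>C\<^esub> p A (ord_suc m) m =
          p A (ord_suc n) n \<cdot>\<^bsub>C\<^esub> on_arr F (w A m n)" if "m \<le> n"
        using A.w_p[OF less_ord_suc _ UNIV_I, of m "ord_suc n"] A.p_w[OF that less_ord_suc UNIV_I] that
        by simp
      show "colimit (below n) C \<lparr>on_obj = X A, on_arr = \<lambda>(i, j). w A i j\<rparr> (X A n) (\<lambda>m. w A m n)"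
        if "ord_limit n"
        using that by (rule A.colimit_below[OF UNIV_I])
    qed
  qed
  have "is_term_chain C F T"
    unfolding is_term_chain_def
    by (intro conjI allI ballI impI) (simp_all add: func link inj zero pointwise)
  then show ?thesis by blast
qed

section \<open>Freeness of every term chain\<close>

lemma is_term_chainD:
  assumes "is_term_chain C F T"
  shows "is_functor C C (trm T n)"
    "m \<le> n \<Longrightarrow> nat_trans C C (trm T m) (trm T n) (lnk T m n)"
    "A \<in> Obj C \<Longrightarrow> lnk T n n A = Ide C (on_obj (trm T n) A)"
    "\<lbrakk>A \<in> Obj C; k \<le> m; m \<le> n\<rbrakk> \<Longrightarrow> lnk T m n A \<cdot>\<^bsub>C\<^esub> lnk T k m A = lnk T k n A"
    "A \<in> Obj C \<Longrightarrow> on_obj (trm T ord_zero) A = A"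
    "A \<in> Obj C \<Longrightarrow> coproduct C (on_obj F (on_obj (trm T n) A)) A (on_obj (trm T (ord_suc n)) A)
        (qinj T n A) (lnk T ord_zero (ord_suc n) A)"
    "\<lbrakk>A \<in> Obj C; m \<le> n\<rbrakk> \<Longrightarrow> lnk T (ord_suc m) (ord_suc n) A \<cdot>\<^bsub>C\<^esub> qinj T m A
          = qinj T n A \<cdot>\<^bsub>C\<^esub> on_arr F (lnk T m n A)"
    "\<lbrakk>A \<in> Obj C; ord_limit n\<rbrakk> \<Longrightarrow> colimit (below n) C
          \<lparr>on_obj = \<lambda>m. on_obj (trm T m) A, on_arr = \<lambda>(i, j). lnk T i j A\<rparr>
          (on_obj (trm T n) A) (\<lambda>m. lnk T m n A)"
  using assms unfolding is_term_chain_def by (elim conjE; simp)+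

text \<open>The converse of the construction: the successor and limit clauses force freeness at
  every stage. It therefore also covers the chain picked by \<open>SOME\<close>, about which only
  \<open>is_term_chain\<close> is known.\<close>

lemma free_chain_term_chain:
  fixes T :: "('k::ordinals, 'o, 'm) term_chain"
  assumes T: "is_term_chain C F T" and A: "A \<in> Obj C"
  shows "free_chain C F UNIV A (\<lambda>n. on_obj (trm T n) A) (\<lambda>m n. lnk T m n A)
    (\<lambda>n. lnk T ord_zero n A) (\<lambda>n k. lnk T (ord_suc k) n A \<cdot>\<^bsub>C\<^esub> qinj T k A)"
proof -
  let ?X = "\<lambda>n. on_obj (trm T n) A" and ?w = "\<lambda>m n. lnk T m n A"
  let ?i = "\<lambda>n. ?w ord_zero n" and ?p = "\<lambda>n k. ?w (ord_suc k) n \<cdot>\<^bsub>C\<^esub> qinj T k A"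
  note TD = is_term_chainD[OF T]
  have w_refl: "?w n n = Ide C (?X n)" for n using A by (rule TD(3))
  have w_trans: "?w m n \<cdot>\<^bsub>C\<^esub> ?w k m = ?w k n" if "k \<le> m" "m \<le> n" for k m n
    using A that by (rule TD(4))
  have zero: "?X ord_zero = A" using A by (rule TD(5))
  have X_obj: "?X n \<in> Obj C" for n using is_functor.on_obj[OF TD(1) A] .
  have w_hom: "?w m n \<in> hom C (?X m) (?X n)" if "m \<le> n" for m n
    using TD(2)[OF that] A by (simp add: nat_trans_def)
  have i_hom: "?i n \<in> hom C A (?X n)" for n
    using w_hom[OF ord_zero_le] by (simp add: zero)
  have q_hom: "qinj T n A \<in> hom C (on_obj F (?X n)) (?X (ord_suc n))" for n
    using TD(6)[OF A] by (simp add: coproduct_def)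
  have q_w: "?w (ord_suc m) (ord_suc n) \<cdot>\<^bsub>C\<^esub> qinj T m A = qinj T n A \<cdot>\<^bsub>C\<^esub> on_arr F (?w m n)"
    if "m \<le> n" for m n using A that by (rule TD(7))
  have F_w: "on_arr F (?w m n) \<in> hom C (on_obj F (?X m)) (on_obj F (?X n))" if "m \<le> n" for m n
    using w_hom[OF that] by (rule on_arr)
  have p_hom: "?p n k \<in> hom C (on_obj F (?X k)) (?X n)" if "k < n" for n k
    using q_hom w_hom by (rule comp_hom) (simp add: ord_suc_le_iff that)
  have chain: "chain C F UNIV A ?X ?w ?i ?p"
  proof
    show "term_cone A ?X ?w n (?X n) (?i n) (?p n)" for n
    proof (rule term_coneI[OF X_obj i_hom p_hom])
      show "?p n k \<cdot>\<^bsub>C\<^esub> on_arr F (?w j k) = ?p n j" if jk: "j \<le> k" and k: "k < n" for j k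
      proof -
        have sk: "ord_suc k \<le> n" using k by (simp add: ord_suc_le_iff)
        have sj: "ord_suc j \<le> ord_suc k" using jk by simp
        show ?thesis
          using comp_assoc[OF F_w[OF jk] q_hom w_hom[OF sk]] q_w[OF jk]
            comp_assoc[OF q_hom w_hom[OF sj] w_hom[OF sk]] w_trans[OF sj sk] by simp
      qed
    qed
    show "?w m n \<cdot>\<^bsub>C\<^esub> ?p m k = ?p n k" if "k < m" "m \<le> n" for k m n
    proof -
      have sk: "ord_suc k \<le> m" using that by (simp add: ord_suc_le_iff)
      show ?thesis
        using comp_assoc[OF q_hom w_hom[OF sk] w_hom[OF that(2)]] w_trans[OF sk that(2)] by simp
    qed
  qed (simp_all add: w_hom w_trans)
  interpret ch: chain C F UNIV A ?X ?w ?i ?p by (rule chain)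
  have p_suc: "?p (ord_suc n) n = qinj T n A" for n
    using ide_left[OF q_hom] by (simp add: w_refl)
  \<comment> \<open>Induction on the stage: the coproduct handles successors, while at limits the
    mediating arrows from the earlier stages are glued along the colimit.\<close>
  have univ: "\<exists>!h. h \<in> hom C (?X n) z \<and> h \<cdot>\<^bsub>C\<^esub> ?i n = g \<and> (\<forall>k<n. h \<cdot>\<^bsub>C\<^esub> ?p n k = \<pi> k)"
    if "term_cone A ?X ?w n z g \<pi>" for n z g \<pi>
    using that
  proof (induction n rule: less_induct)
    case (less n)
    note c = term_coneD[OF less.prems]
    show ?case
    proof (cases n rule: ord_cases)
      case zero
      then show ?thesis
        using c(2) ide_right[of _ A z] by (auto simp: w_refl TD(5)[OF A])
    next
      case (suc m)
      have m: "m < n" by (simp add: suc)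
      have univ: "\<exists>!h. h \<in> hom C (?X n) z \<and> h \<cdot>\<^bsub>C\<^esub> qinj T m A = \<pi> m \<and> h \<cdot>\<^bsub>C\<^esub> ?i n = g"
        using TD(6)[OF A, of m] c(1) c(3)[OF m] c(2) unfolding coproduct_def suc by blast
      have eq: "(\<forall>k<n. h \<cdot>\<^bsub>C\<^esub> ?p n k = \<pi> k) \<longleftrightarrow> h \<cdot>\<^bsub>C\<^esub> qinj T m A = \<pi> m"
        if h: "h \<in> hom C (?X n) z" for h
      proof
        show "h \<cdot>\<^bsub>C\<^esub> qinj T m A = \<pi> m" if "\<forall>k<n. h \<cdot>\<^bsub>C\<^esub> ?p n k = \<pi> k"
          using spec[OF that, of m] m p_suc[of m] by (simp add: suc)
        show "\<forall>k<n. h \<cdot>\<^bsub>C\<^esub> ?p n k = \<pi> k" if eq: "h \<cdot>\<^bsub>C\<^esub> qinj T m A = \<pi> m"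
        proof (intro allI impI)
          fix k assume "k < n"
          then have k: "k \<le> m" by (simp add: suc less_ord_suc_iff)
          have "?p n k = qinj T m A \<cdot>\<^bsub>C\<^esub> on_arr F (?w k m)"
            using q_w[OF k] by (simp add: suc)
          then show "h \<cdot>\<^bsub>C\<^esub> ?p n k = \<pi> k"
            using comp_assoc[OF F_w[OF k] q_hom h[unfolded suc]] c(4)[OF k m] eq by simp
        qed
      qed
      show ?thesis by (rule ex1_cong_on[OF univ]) (simp only: eq conj_commute)
    next
      case limit
      note suc = ord_limit_suc[OF limit]
      have "\<exists>!h. h \<in> hom C (?X m) z \<and> h \<cdot>\<^bsub>C\<^esub> ?i m = g \<and> (\<forall>k<m. h \<cdot>\<^bsub>C\<^esub> ?p m k = \<pi> k)"
        if "m < n" for m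
        using less.IH[OF that term_cone_mono[OF less.prems]] that by simp
      then obtain d where d: "\<And>m. m < n \<Longrightarrow> d m \<in> hom C (?X m) z"
        and d_i: "\<And>m. m < n \<Longrightarrow> d m \<cdot>\<^bsub>C\<^esub> ?i m = g"
        and d_p: "\<And>m k. \<lbrakk>m < n; k < m\<rbrakk> \<Longrightarrow> d m \<cdot>\<^bsub>C\<^esub> ?p m k = \<pi> k"
        and d_eq: "\<And>m h. \<lbrakk>m < n; h \<in> hom C (?X m) z; h \<cdot>\<^bsub>C\<^esub> ?i m = g;
          \<forall>k<m. h \<cdot>\<^bsub>C\<^esub> ?p m k = \<pi> k\<rbrakk> \<Longrightarrow> h = d m"
        by metis
      \<comment> \<open>By uniqueness at \<open>m\<close>, restricting any mediating arrow gives
        \<open>d m\<close>. With \<open>l\<close> below \<open>n\<close> this makes \<open>d\<close>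
        a cocone; with \<open>l\<close> equal to \<open>n\<close> it identifies the two descriptions
        of mediating arrows.\<close>
      have restrict: "h \<cdot>\<^bsub>C\<^esub> ?w m l = d m"
        if h: "h \<in> hom C (?X l) z" "h \<cdot>\<^bsub>C\<^esub> ?i l = g" "\<forall>k<l. h \<cdot>\<^bsub>C\<^esub> ?p l k = \<pi> k"
          and ml: "m \<le> l" and m: "m < n" for h m l
      proof (rule d_eq[OF m])
        show "h \<cdot>\<^bsub>C\<^esub> ?w m l \<in> hom C (?X m) z" using w_hom[OF ml] h(1) by (rule comp_hom)
        show "(h \<cdot>\<^bsub>C\<^esub> ?w m l) \<cdot>\<^bsub>C\<^esub> ?i m = g"
          using comp_assoc[OF i_hom w_hom[OF ml] h(1)] w_trans[OF ord_zero_le ml] h(2) by simp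
        show "\<forall>k<m. (h \<cdot>\<^bsub>C\<^esub> ?w m l) \<cdot>\<^bsub>C\<^esub> ?p m k = \<pi> k"
          using comp_assoc[OF p_hom w_hom[OF ml] h(1)] ch.w_p[OF _ ml UNIV_I] h(3) ml by simp
      qed
      have "cocone (below n) C \<lparr>on_obj = ?X, on_arr = \<lambda>(i, j). ?w i j\<rparr> z d"
        using c(1) d restrict[OF d d_i] d_p by (auto simp: cocone_def below_def)
      then have univ: "\<exists>!h. h \<in> hom C (?X n) z \<and> (\<forall>m\<in>Obj (below n). h \<cdot>\<^bsub>C\<^esub> ?w m n = d m)"
        using TD(8)[OF A limit] unfolding colimit_def by blast
      have eq: "(\<forall>m\<in>Obj (below n). h \<cdot>\<^bsub>C\<^esub> ?w m n = d m) \<longleftrightarrow>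
          h \<cdot>\<^bsub>C\<^esub> ?i n = g \<and> (\<forall>k<n. h \<cdot>\<^bsub>C\<^esub> ?p n k = \<pi> k)" (is "?L \<longleftrightarrow> ?R")
        if h: "h \<in> hom C (?X n) z" for h
      proof
        assume ?L
        then have L: "h \<cdot>\<^bsub>C\<^esub> ?w m n = d m" if "m < n" for m using that by (simp add: below_def)
        show ?R
        proof (intro conjI allI impI)
          show "h \<cdot>\<^bsub>C\<^esub> ?i n = g"
            using L[OF ord_limit_zero[OF limit]] d_i[OF ord_limit_zero[OF limit]]
              ide_right d[OF ord_limit_zero[OF limit]] by (simp add: w_refl)
          show "h \<cdot>\<^bsub>C\<^esub> ?p n k = \<pi> k" if k: "k < n" for k
            using comp_assoc[OF q_hom w_hom[OF less_imp_le[OF suc[OF k]]] h] L[OF suc[OF k]]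
              d_p[OF suc[OF k] less_ord_suc] p_suc[of k] by simp
        qed
      next
        assume ?R
        then show ?L using restrict[OF h] by (simp add: below_def)
      qed
      show ?thesis by (rule ex1_cong_on[OF univ]) (simp only: eq)
    qed
  qed
  show ?thesis
    by unfold_locales (simp add: free_cone_def ch.cone univ)
qed

end


section \<open>Term evaluation\<close>

context endofunctor
begin

lemma term_chain_of: "cocomplete (U :: 'k::ordinals itself) C \<Longrightarrow>
    is_term_chain C F (term_chain_of C F :: ('k, 'o, 'm) term_chain)"
  unfolding term_chain_of_def by (rule someI_ex) (rule ex_term_chain)

text \<open>Evaluation is the fold of the term chain over \<open>A\<close> into the constant chain
  at the algebra. Naturality of the fold gives compatibility with all links, where the defining
  clauses mention only those into limits.\<close>

lemma
  fixes U :: "'k::ordinals itself"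
  assumes coc: "cocomplete U C" and alg: "(A, \<alpha>) \<in> algebras C F"
  shows is_term_eval_term_eval: "is_term_eval C F (A, \<alpha>) (term_eval C F (A, \<alpha>) :: 'k \<Rightarrow> 'm)"
    and term_eval_link: "m \<le> n \<Longrightarrow>
      term_eval C F (A, \<alpha>) n \<cdot>\<^bsub>C\<^esub> term_link C F m n A = term_eval C F (A, \<alpha>) (m :: 'k)"
proof -
  let ?T = "term_chain_of C F :: ('k, 'o, 'm) term_chain"
  have A: "A \<in> Obj C" and \<alpha>: "\<alpha> \<in> hom C (on_obj F A) A"
    using alg by (simp_all add: algebras_def)
  have T: "is_term_chain C F ?T" using coc by (rule term_chain_of)
  note TD = is_term_chainD[OF T]
  let ?X = "\<lambda>n. on_obj (trm ?T n) A" and ?w = "\<lambda>m n. lnk ?T m n A"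
  let ?i = "\<lambda>n. ?w ord_zero n" and ?p = "\<lambda>n k. ?w (ord_suc k) n \<cdot>\<^bsub>C\<^esub> qinj ?T k A"
  interpret X: free_chain C F UNIV A ?X ?w ?i ?p
    by (rule free_chain_term_chain[OF T A])
  \<comment> \<open>The constant chain has identities as links and as arrows from \<open>A\<close>,
    and the structure map \<open>\<alpha>\<close> as each arrow from \<open>F A\<close>.\<close>
  interpret folding C F A ?X ?w ?i ?p "\<lambda>n. A" "\<lambda>m n. Ide C A" "\<lambda>n. Ide C A" "\<lambda>n k. \<alpha>"
  proof
    show "term_cone A (\<lambda>n. A) (\<lambda>m n. Ide C A) n A (Ide C A) (\<lambda>k. \<alpha>)" for n
      using A \<alpha> ide_right[OF \<alpha>] by (simp add: term_cone_def ide_hom on_ide)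
  qed (use A ide_left[OF \<alpha>] ide_left[OF ide_hom[OF A]] in \<open>simp_all add: ide_hom\<close>)
  obtain \<epsilon> where \<epsilon>: "\<And>n. fold_at \<epsilon> n (\<epsilon> n)" using ex_fold by blast
  note \<epsilon>D = fold_atD[OF \<epsilon>]
  have link: "\<epsilon> n \<cdot>\<^bsub>C\<^esub> ?w m n = \<epsilon> m" if "m \<le> n" for m n
    using fold_natural[of n \<epsilon> m] \<epsilon> that ide_left[OF \<epsilon>D(1)] by simp
  have "is_term_eval C F (A, \<alpha>) \<epsilon>"
    unfolding is_term_eval_def prod.case
  proof (intro conjI allI impI)
    show "\<epsilon> n \<in> hom C (?X n) A" for n by (rule \<epsilon>D(1))
    show "\<epsilon> ord_zero = Ide C A"
      using \<epsilon>D(2)[of ord_zero] ide_right[OF \<epsilon>D(1), of ord_zero] by (simp add: X.w_refl)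
    show "\<epsilon> (ord_suc n) \<cdot>\<^bsub>C\<^esub> qinj ?T n A = \<alpha> \<cdot>\<^bsub>C\<^esub> on_arr F (\<epsilon> n)" for n
    proof -
      have "qinj ?T n A \<in> hom C (on_obj F (?X n)) (?X (ord_suc n))"
        using TD(6)[OF A] by (simp add: coproduct_def)
      from ide_left[OF this] show ?thesis
        using \<epsilon>D(3)[OF less_ord_suc, of n] by (simp add: X.w_refl)
    qed
    show "\<epsilon> (ord_suc n) \<cdot>\<^bsub>C\<^esub> ?w ord_zero (ord_suc n) = Ide C A" for n by (rule \<epsilon>D(2))
    show "\<epsilon> l \<cdot>\<^bsub>C\<^esub> ?w m l = \<epsilon> m" if "ord_limit l \<and> m < l" for l m
      using that by (simp add: link less_imp_le)
  qed
  \<comment> \<open>Uniqueness makes the \<open>THE\<close> in \<open>term_eval\<close> denote. It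
    is shown from the clauses of \<open>is_term_eval\<close>, using the coproduct at successors and
    the colimit at limits.\<close>
  moreover have "\<epsilon>' = \<epsilon>''"
    if "is_term_eval C F (A, \<alpha>) \<epsilon>'" "is_term_eval C F (A, \<alpha>) \<epsilon>''" for \<epsilon>' \<epsilon>'' :: "'k \<Rightarrow> 'm"
  proof
    have evalD: "\<delta> n \<in> hom C (?X n) A" "\<delta> ord_zero = Ide C A"
      "\<delta> (ord_suc n) \<cdot>\<^bsub>C\<^esub> qinj ?T n A = \<alpha> \<cdot>\<^bsub>C\<^esub> on_arr F (\<delta> n)"
      "\<delta> (ord_suc n) \<cdot>\<^bsub>C\<^esub> ?w ord_zero (ord_suc n) = Ide C A"
      "\<lbrakk>ord_limit n; m < n\<rbrakk> \<Longrightarrow> \<delta> n \<cdot>\<^bsub>C\<^esub> ?w m n = \<delta> m"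
      if "is_term_eval C F (A, \<alpha>) \<delta>" for \<delta> :: "'k \<Rightarrow> 'm" and m n
      using that by (simp_all add: is_term_eval_def)
    note e' = evalD[OF that(1)] and e'' = evalD[OF that(2)]
    show "\<epsilon>' n = \<epsilon>'' n" for n
    proof (induction n rule: less_induct)
      case (less n)
      show ?case
      proof (cases n rule: ord_cases)
        case zero
        then show ?thesis by (simp add: e'(2) e''(2))
      next
        case (suc m)
        have IH: "\<epsilon>' m = \<epsilon>'' m" by (rule less) (simp add: suc)
        have "\<alpha> \<cdot>\<^bsub>C\<^esub> on_arr F (\<epsilon>'' m) \<in> hom C (on_obj F (?X m)) A"
          using on_arr[OF e''(1)] \<alpha> by (rule comp_hom)
        then have "\<exists>!h. h \<in> hom C (?X (ord_suc m)) A \<and> h \<cdot>\<^bsub>C\<^esub> qinj ?T m A = \<alpha> \<cdot>\<^bsub>C\<^esub> on_arr F (\<epsilon>'' m) \<and>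
            h \<cdot>\<^bsub>C\<^esub> ?w ord_zero (ord_suc m) = Ide C A"
          using TD(6)[OF A, of m] A ide_hom[OF A] unfolding coproduct_def by blast
        then show ?thesis
          unfolding suc by (rule ex1E) (metis IH e'(1,3,4) e''(1,3,4))
      next
        case limit
        have "cocone (below n) C \<lparr>on_obj = ?X, on_arr = \<lambda>(i, j). ?w i j\<rparr> A \<epsilon>''"
          unfolding cocone_def
        proof (intro conjI ballI)
          show "\<epsilon>'' (Cod (below n) u) \<cdot>\<^bsub>C\<^esub> on_arr \<lparr>on_obj = ?X, on_arr = \<lambda>(i, j). ?w i j\<rparr> u
              = \<epsilon>'' (Dom (below n) u)" if u: "u \<in> Arr (below n)" for u
          proof -
            obtain j k where jk: "u = (j, k)" "j \<le> k" "k < n" using u by (auto simp: below_def)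
            \<comment> \<open>The links below the limit need not end in a limit, so compatibility
              there is obtained by passing through the value at \<open>n\<close>.\<close>
            have "\<epsilon>'' k \<cdot>\<^bsub>C\<^esub> ?w j k = (\<epsilon>'' n \<cdot>\<^bsub>C\<^esub> ?w k n) \<cdot>\<^bsub>C\<^esub> ?w j k"
              using e''(5)[OF limit jk(3)] by simp
            also have "\<dots> = \<epsilon>'' n \<cdot>\<^bsub>C\<^esub> ?w j n"
              using comp_assoc[OF X.w_hom[OF jk(2) UNIV_I] X.w_hom[OF less_imp_le[OF jk(3)] UNIV_I]
                  e''(1)] X.w_trans[OF jk(2) less_imp_le[OF jk(3)] UNIV_I] by simp
            also have "\<dots> = \<epsilon>'' j"
              using jk by (intro e''(5)[OF limit]) simp
            finally show ?thesis by (simp add: jk below_def)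
          qed
        qed (use A e''(1) in simp_all)
        then have "\<exists>!h. h \<in> hom C (?X n) A \<and> (\<forall>m\<in>Obj (below n). h \<cdot>\<^bsub>C\<^esub> ?w m n = \<epsilon>'' m)"
          using TD(8)[OF A limit] unfolding colimit_def by blast
        moreover have "\<forall>m\<in>Obj (below n). \<epsilon>' n \<cdot>\<^bsub>C\<^esub> ?w m n = \<epsilon>'' m"
          "\<forall>m\<in>Obj (below n). \<epsilon>'' n \<cdot>\<^bsub>C\<^esub> ?w m n = \<epsilon>'' m"
          using less e'(5)[OF limit] e''(5)[OF limit] by (simp_all add: below_def)
        ultimately show ?thesis using e'(1) e''(1) by (elim ex1E) metis
      qed
    qed
  qed
  ultimately have "term_eval C F (A, \<alpha>) = \<epsilon>" and eval: "is_term_eval C F (A, \<alpha>) \<epsilon>"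
    unfolding term_eval_def by (blast intro: the_equality)+
  then show "is_term_eval C F (A, \<alpha>) (term_eval C F (A, \<alpha>) :: 'k \<Rightarrow> 'm)"
    and "m \<le> n \<Longrightarrow> term_eval C F (A, \<alpha>) n \<cdot>\<^bsub>C\<^esub> term_link C F m n A = term_eval C F (A, \<alpha>) m"
    using link by simp_all
qed

end


section \<open>Copowers of representable functors\<close>

lemma nat_transD:
  assumes "nat_trans C D F G t"
  shows "a \<in> Obj C \<Longrightarrow> t a \<in> hom D (on_obj F a) (on_obj G a)"
    and "\<lbrakk>a \<in> Obj C; b \<in> Obj C; f \<in> hom C a b\<rbrakk> \<Longrightarrow> t b \<cdot>\<^bsub>D\<^esub> on_arr F f = on_arr G f \<cdot>\<^bsub>D\<^esub> t a"
  using assms unfolding nat_trans_def by simp_all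

context category
begin

text \<open>
  The functor \<open>G\<close> obtained here is \<open>A \<mapsto> hom(X, A) \<bullet> R\<close>. By the Yoneda lemma and the universal
  property of the copower, a natural transformation \<open>G \<rightarrow> H\<close> is the same as an arrow \<open>R \<rightarrow> H X\<close>.
\<close>

lemma ex_copower_functor:
  fixes U :: "'k::ordinals itself"
  assumes coc: "cocomplete U C" and small: "locally_small U C"
    and X: "X \<in> Obj C" and R: "R \<in> Obj C"
  shows "\<exists>G c. is_functor C C G \<and>
    (\<forall>A. \<forall>f\<in>hom C X A. c A f \<in> hom C R (on_obj G A)) \<and>
    (\<forall>A\<in>Obj C. \<forall>z. \<forall>h\<in>hom C (on_obj G A) z. \<forall>h'\<in>hom C (on_obj G A) z.
      (\<forall>f\<in>hom C X A. h \<cdot>\<^bsub>C\<^esub> c A f = h' \<cdot>\<^bsub>C\<^esub> c A f) \<longrightarrow> h = h') \<and>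
    (\<forall>H. is_functor C C H \<longrightarrow> (\<forall>r\<in>hom C R (on_obj H X). \<exists>\<phi>. nat_trans C C G H \<phi> \<and>
      (\<forall>A\<in>Obj C. \<forall>f\<in>hom C X A. \<phi> A \<cdot>\<^bsub>C\<^esub> c A f = on_arr H f \<cdot>\<^bsub>C\<^esub> r)))"
proof -
  \<comment> \<open>Copower and injections are packed into one pair, so that a single choice over
    all objects selects both.\<close>
  have "\<exists>Pc. fst Pc \<in> Obj C \<and> (\<forall>f\<in>hom C X A. snd Pc f \<in> hom C R (fst Pc)) \<and>
      (\<forall>b e. b \<in> Obj C \<longrightarrow> (\<forall>f\<in>hom C X A. e f \<in> hom C R b) \<longrightarrow>
        (\<exists>!h. h \<in> hom C (fst Pc) b \<and> (\<forall>f\<in>hom C X A. h \<cdot>\<^bsub>C\<^esub> snd Pc f = e f)))"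
    if A: "A \<in> Obj C" for A
  proof -
    have S: "small U (hom C X A)" using small X A by (simp add: locally_small_def)
    obtain P c where P: "P \<in> Obj C" "\<And>f. f \<in> hom C X A \<Longrightarrow> c f \<in> hom C R P"
      and univ: "\<And>b e. \<lbrakk>b \<in> Obj C; \<And>f. f \<in> hom C X A \<Longrightarrow> e f \<in> hom C R b;
          \<And>f g. \<lbrakk>f \<in> hom C X A; g \<in> hom C X A; f = g\<rbrakk> \<Longrightarrow> e g \<cdot>\<^bsub>C\<^esub> Ide C R = e f\<rbrakk>
        \<Longrightarrow> \<exists>!h. h \<in> hom C P b \<and> (\<forall>f\<in>hom C X A. h \<cdot>\<^bsub>C\<^esub> c f = e f)"
    \<comment> \<open>With equality as the preorder the diagram is discrete, so its colimit is the
      coproduct of copies of \<open>R\<close> indexed by the arrows from \<open>X\<close> to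
      \<open>A\<close>; local smallness makes it a small one.\<close>
    proof (rule preorder_colimit[OF coc S, of "(=)" "\<lambda>_. R" "\<lambda>_ _. Ide C R"])
      show "Ide C R \<cdot>\<^bsub>C\<^esub> Ide C R = Ide C R" using ide_hom[OF R] by (rule ide_left)
    qed (assumption | rule R ide_hom refl | erule (1) trans | blast)+
    have "\<exists>!h. h \<in> hom C P b \<and> (\<forall>f\<in>hom C X A. h \<cdot>\<^bsub>C\<^esub> c f = e f)"
      if "b \<in> Obj C" "\<forall>f\<in>hom C X A. e f \<in> hom C R b" for b e
      using that by (intro univ) (simp_all add: ide_right[of _ R b])
    with P show ?thesis by (intro exI[of _ "(P, c)"]) simp
  qed
  then obtain Pc where Pc: "\<forall>A\<in>Obj C. fst (Pc A) \<in> Obj C \<and>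
      (\<forall>f\<in>hom C X A. snd (Pc A) f \<in> hom C R (fst (Pc A))) \<and>
      (\<forall>b e. b \<in> Obj C \<longrightarrow> (\<forall>f\<in>hom C X A. e f \<in> hom C R b) \<longrightarrow>
        (\<exists>!h. h \<in> hom C (fst (Pc A)) b \<and> (\<forall>f\<in>hom C X A. h \<cdot>\<^bsub>C\<^esub> snd (Pc A) f = e f)))"
    using bchoice[of "Obj C"] by (metis (no_types, lifting))
  define P where "P A = fst (Pc A)" for A
  define c where "c A = snd (Pc A)" for A
  have P_obj: "P A \<in> Obj C" if "A \<in> Obj C" for A using Pc that by (simp add: P_def)
  have c_hom: "c A f \<in> hom C R (P A)" if "f \<in> hom C X A" for A f
    using Pc that hom_obj(2)[OF that] by (simp add: P_def c_def)
  have univ: "\<exists>!h. h \<in> hom C (P A) b \<and> (\<forall>f\<in>hom C X A. h \<cdot>\<^bsub>C\<^esub> c A f = e f)"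
    if "A \<in> Obj C" "b \<in> Obj C" "\<And>f. f \<in> hom C X A \<Longrightarrow> e f \<in> hom C R b" for A b e
    using Pc that by (simp add: P_def c_def)
  have ext: "h = h'" if A: "A \<in> Obj C" and h: "h \<in> hom C (P A) z" and h': "h' \<in> hom C (P A) z"
      and eq: "\<And>f. f \<in> hom C X A \<Longrightarrow> h \<cdot>\<^bsub>C\<^esub> c A f = h' \<cdot>\<^bsub>C\<^esub> c A f" for A z h h'
    using univ[OF A hom_obj(2)[OF h], of "\<lambda>f. h' \<cdot>\<^bsub>C\<^esub> c A f"] comp_hom[OF c_hom h'] h h' eq by blast
  define lift where "lift A B e = (THE h. h \<in> hom C (P A) B \<and> (\<forall>f\<in>hom C X A. h \<cdot>\<^bsub>C\<^esub> c A f = e f))"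
    for A B e
  have lift: "lift A b e \<in> hom C (P A) b"
    "\<And>f. f \<in> hom C X A \<Longrightarrow> lift A b e \<cdot>\<^bsub>C\<^esub> c A f = e f"
    if "A \<in> Obj C" "b \<in> Obj C" "\<And>f. f \<in> hom C X A \<Longrightarrow> e f \<in> hom C R b" for A b e
    using theI'[OF univ[OF that]] by (simp_all add: lift_def)
  \<comment> \<open>Postcomposition reindexes the summands: \<open>u\<close> sends the copy of
    \<open>R\<close> at \<open>f\<close> to the copy at the composite of \<open>u\<close> and
    \<open>f\<close>.\<close>
  define G where "G = \<lparr>on_obj = P,
    on_arr = (\<lambda>u. lift (Dom C u) (P (Cod C u)) (\<lambda>f. c (Cod C u) (u \<cdot>\<^bsub>C\<^esub> f)))\<rparr>"
  have G_obj: "on_obj G A = P A" for A by (simp add: G_def)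
  have G: "on_arr G u \<in> hom C (P A) (P B)"
    "\<And>f. f \<in> hom C X A \<Longrightarrow> on_arr G u \<cdot>\<^bsub>C\<^esub> c A f = c B (u \<cdot>\<^bsub>C\<^esub> f)" if u: "u \<in> hom C A B" for u A B
    using lift[OF hom_obj(1)[OF u] P_obj[OF hom_obj(2)[OF u]], of "\<lambda>f. c B (u \<cdot>\<^bsub>C\<^esub> f)"]
      c_hom[OF comp_hom[OF _ u]] homD[OF u] by (simp_all add: G_def)
  have G_functor: "is_functor C C G"
  proof
    show "on_obj G A \<in> Obj C" if "A \<in> Obj C" for A using that by (simp add: G_obj P_obj)
    show "on_arr G u \<in> hom C (on_obj G A) (on_obj G B)" if "u \<in> hom C A B" for u A B
      using G(1)[OF that] by (simp add: G_obj)
    show "on_arr G (Ide C A) = Ide C (on_obj G A)" if A: "A \<in> Obj C" for A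
      unfolding G_obj
    proof (rule ext[OF A G(1)[OF ide_hom[OF A]] ide_hom[OF P_obj[OF A]]])
      show "on_arr G (Ide C A) \<cdot>\<^bsub>C\<^esub> c A f = Ide C (P A) \<cdot>\<^bsub>C\<^esub> c A f" if "f \<in> hom C X A" for f
        using G(2)[OF ide_hom[OF A] that] ide_left[OF that] ide_left[OF c_hom[OF that]] by simp
    qed
    show "on_arr G (v \<cdot>\<^bsub>C\<^esub> u) = on_arr G v \<cdot>\<^bsub>C\<^esub> on_arr G u"
      if u: "u \<in> hom C A B" and v: "v \<in> hom C B D" for u v A B D
    proof (rule ext[OF hom_obj(1)[OF u] G(1)[OF comp_hom[OF u v]] comp_hom[OF G(1)[OF u] G(1)[OF v]]])
      show "on_arr G (v \<cdot>\<^bsub>C\<^esub> u) \<cdot>\<^bsub>C\<^esub> c A f = (on_arr G v \<cdot>\<^bsub>C\<^esub> on_arr G u) \<cdot>\<^bsub>C\<^esub> c A f"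
        if f: "f \<in> hom C X A" for f
        using G(2)[OF comp_hom[OF u v] f] comp_assoc[OF c_hom[OF f] G(1)[OF u] G(1)[OF v]]
          G(2)[OF u f] G(2)[OF v comp_hom[OF f u]] comp_assoc[OF f u v] by simp
    qed
  qed
  have yoneda: "\<exists>\<phi>. nat_trans C C G H \<phi> \<and>
      (\<forall>A\<in>Obj C. \<forall>f\<in>hom C X A. \<phi> A \<cdot>\<^bsub>C\<^esub> c A f = on_arr H f \<cdot>\<^bsub>C\<^esub> r)"
    if H: "is_functor C C H" and r: "r \<in> hom C R (on_obj H X)" for H r
  proof -
    interpret H: is_functor C C H by (rule H)
    \<comment> \<open>The Yoneda formula: \<open>r\<close> is the component at the identity of
      \<open>X\<close>, and naturality dictates the component at any \<open>f\<close>.\<close>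
    define \<phi> where "\<phi> A = lift A (on_obj H A) (\<lambda>f. on_arr H f \<cdot>\<^bsub>C\<^esub> r)" for A
    have \<phi>: "\<phi> A \<in> hom C (P A) (on_obj H A)"
      "\<And>f. f \<in> hom C X A \<Longrightarrow> \<phi> A \<cdot>\<^bsub>C\<^esub> c A f = on_arr H f \<cdot>\<^bsub>C\<^esub> r" if A: "A \<in> Obj C" for A
      using lift[OF A H.on_obj[OF A] comp_hom[OF r H.on_arr]] by (simp_all add: \<phi>_def)
    have "\<phi> B \<cdot>\<^bsub>C\<^esub> on_arr G u = on_arr H u \<cdot>\<^bsub>C\<^esub> \<phi> A" if u: "u \<in> hom C A B" for u A B
    proof -
      note A = hom_obj(1)[OF u] and B = hom_obj(2)[OF u]
      show ?thesis
      proof (rule ext[OF A comp_hom[OF G(1)[OF u] \<phi>(1)[OF B]] comp_hom[OF \<phi>(1)[OF A] H.on_arr[OF u]]])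
        show "(\<phi> B \<cdot>\<^bsub>C\<^esub> on_arr G u) \<cdot>\<^bsub>C\<^esub> c A f = (on_arr H u \<cdot>\<^bsub>C\<^esub> \<phi> A) \<cdot>\<^bsub>C\<^esub> c A f"
          if f: "f \<in> hom C X A" for f
          using comp_assoc[OF c_hom[OF f] G(1)[OF u] \<phi>(1)[OF B]] G(2)[OF u f]
            comp_assoc[OF c_hom[OF f] \<phi>(1)[OF A] H.on_arr[OF u]] \<phi>(2)[OF A f]
            \<phi>(2)[OF B comp_hom[OF f u]] H.on_comp[OF f u]
            comp_assoc[OF r H.on_arr[OF f] H.on_arr[OF u]] by simp
      qed
    qed
    then have "nat_trans C C G H \<phi>"
      using \<phi>(1) by (simp add: nat_trans_def G_obj)
    with \<phi>(2) show ?thesis by (intro exI[of _ \<phi>] conjI ballI)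
  qed
  show ?thesis
  proof (intro exI[of _ G] exI[of _ c] conjI allI ballI impI)
    show "is_functor C C G" by (rule G_functor)
    show "c A f \<in> hom C R (on_obj G A)" if "f \<in> hom C X A" for A f
      unfolding G_obj using that by (rule c_hom)
    show "h = h'" if "A \<in> Obj C" "h \<in> hom C (on_obj G A) z" "h' \<in> hom C (on_obj G A) z"
      "\<forall>f\<in>hom C X A. h \<cdot>\<^bsub>C\<^esub> c A f = h' \<cdot>\<^bsub>C\<^esub> c A f" for A z h h'
      by (rule ext[OF that(1) that(2,3)[unfolded G_obj]]) (rule that(4)[rule_format])
  qed (rule yoneda)
qed

end


section \<open>Equations versus natural identities\<close>

context endofunctor
begin

lemma term_eval_hom:
  fixes U :: "'k::ordinals itself" and n :: 'k
  assumes "cocomplete U C" "(A, \<alpha>) \<in> algebras C F"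
  shows "term_eval C F (A, \<alpha>) n \<in> hom C (on_obj (term_functor C F n) A) A"
  using is_term_eval_term_eval[OF assms] by (simp add: is_term_eval_def)

text \<open>An arrow factors through a coequalizer exactly when it equalizes the parallel pair. The
  resulting conditions, one for each \<open>f\<close>, are collected into a single equation on the
  copower.\<close>

lemma ex_identity_of_equation:
  fixes U :: "'k::ordinals itself" and eqn :: "'o \<times> 'k \<times> 'm"
  assumes coc: "cocomplete U C" and small: "locally_small U C" and eqn: "eqn \<in> equation_arrows C F"
  shows "\<exists>I :: ('k, 'o, 'm) nat_identity. I \<in> natural_identities C F \<and>
    (\<forall>a\<in>algebras C F. satisfies_equation C F a eqn \<longleftrightarrow> satisfies_identity C F a I)"
proof -
  obtain X n e where eqn_eq: "eqn = (X, n, e)" by (cases eqn)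
  let ?Fn = "term_functor C F n"
  from eqn obtain R r s where X: "X \<in> Obj C"
    and coeq: "coequalizer C R (on_obj ?Fn X) r s (Cod C e) e"
    by (auto simp: equation_arrows_def regular_epi_def eqn_eq)
  have r: "r \<in> hom C R (on_obj ?Fn X)" and s: "s \<in> hom C R (on_obj ?Fn X)"
    and e: "e \<in> hom C (on_obj ?Fn X) (Cod C e)" and er: "e \<cdot>\<^bsub>C\<^esub> r = e \<cdot>\<^bsub>C\<^esub> s"
    using coeq by (simp_all add: coequalizer_def)
  interpret Fn: is_functor C C ?Fn
    by (rule is_term_chainD(1)[OF term_chain_of[OF coc]])
  obtain G c where G: "is_functor C C G"
    and c: "\<forall>A. \<forall>f\<in>hom C X A. c A f \<in> hom C R (on_obj G A)"
    and ext: "\<forall>A\<in>Obj C. \<forall>z. \<forall>h\<in>hom C (on_obj G A) z. \<forall>h'\<in>hom C (on_obj G A) z.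
      (\<forall>f\<in>hom C X A. h \<cdot>\<^bsub>C\<^esub> c A f = h' \<cdot>\<^bsub>C\<^esub> c A f) \<longrightarrow> h = h'"
    and yoneda: "\<forall>H. is_functor C C H \<longrightarrow> (\<forall>r\<in>hom C R (on_obj H X). \<exists>\<phi>. nat_trans C C G H \<phi> \<and>
      (\<forall>A\<in>Obj C. \<forall>f\<in>hom C X A. \<phi> A \<cdot>\<^bsub>C\<^esub> c A f = on_arr H f \<cdot>\<^bsub>C\<^esub> r))"
    using ex_copower_functor[OF coc small X hom_obj(1)[OF r]] by (elim exE conjE)
  from yoneda[rule_format, OF Fn.is_functor_axioms r] obtain \<phi> where \<phi>: "nat_trans C C G ?Fn \<phi>"
    and \<phi>_c: "\<And>A f. \<lbrakk>A \<in> Obj C; f \<in> hom C X A\<rbrakk> \<Longrightarrow> \<phi> A \<cdot>\<^bsub>C\<^esub> c A f = on_arr ?Fn f \<cdot>\<^bsub>C\<^esub> r" by blast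
  from yoneda[rule_format, OF Fn.is_functor_axioms s] obtain \<psi> where \<psi>: "nat_trans C C G ?Fn \<psi>"
    and \<psi>_c: "\<And>A f. \<lbrakk>A \<in> Obj C; f \<in> hom C X A\<rbrakk> \<Longrightarrow> \<psi> A \<cdot>\<^bsub>C\<^esub> c A f = on_arr ?Fn f \<cdot>\<^bsub>C\<^esub> s" by blast
  have "satisfies_equation C F (A, \<alpha>) eqn \<longleftrightarrow> satisfies_identity C F (A, \<alpha>) (G, (n, \<phi>), (n, \<psi>))"
    if alg: "(A, \<alpha>) \<in> algebras C F" for A \<alpha>
  proof -
    let ?\<epsilon> = "term_eval C F (A, \<alpha>) n"
    have A: "A \<in> Obj C" using alg by (simp add: algebras_def)
    note \<epsilon> = term_eval_hom[OF coc alg, of n]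
    note \<phi>A = nat_transD(1)[OF \<phi> A] and \<psi>A = nat_transD(1)[OF \<psi> A]
    \<comment> \<open>Precomposition with the injection at \<open>f\<close> turns
      \<open>\<phi> A\<close> and \<open>\<psi> A\<close> into \<open>r\<close> and \<open>s\<close>
      followed by the term functor applied to \<open>f\<close>.\<close>
    have factors: "(\<exists>h\<in>hom C (Cod C e) A. ?\<epsilon> \<cdot>\<^bsub>C\<^esub> on_arr ?Fn f = h \<cdot>\<^bsub>C\<^esub> e) \<longleftrightarrow>
        (?\<epsilon> \<cdot>\<^bsub>C\<^esub> \<phi> A) \<cdot>\<^bsub>C\<^esub> c A f = (?\<epsilon> \<cdot>\<^bsub>C\<^esub> \<psi> A) \<cdot>\<^bsub>C\<^esub> c A f" if f: "f \<in> hom C X A" for f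
    proof -
      let ?g = "?\<epsilon> \<cdot>\<^bsub>C\<^esub> on_arr ?Fn f"
      have g: "?g \<in> hom C (on_obj ?Fn X) A" using Fn.on_arr[OF f] \<epsilon> by (rule comp_hom)
      have "(\<exists>h\<in>hom C (Cod C e) A. ?g = h \<cdot>\<^bsub>C\<^esub> e) \<longleftrightarrow> ?g \<cdot>\<^bsub>C\<^esub> r = ?g \<cdot>\<^bsub>C\<^esub> s"
      proof
        assume "\<exists>h\<in>hom C (Cod C e) A. ?g = h \<cdot>\<^bsub>C\<^esub> e"
        then obtain h where h: "h \<in> hom C (Cod C e) A" and eq: "?g = h \<cdot>\<^bsub>C\<^esub> e" by blast
        show "?g \<cdot>\<^bsub>C\<^esub> r = ?g \<cdot>\<^bsub>C\<^esub> s"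
          unfolding eq using comp_assoc[OF r e h] comp_assoc[OF s e h] er by simp
      next
        assume "?g \<cdot>\<^bsub>C\<^esub> r = ?g \<cdot>\<^bsub>C\<^esub> s"
        then have "\<exists>!h. h \<in> hom C (Cod C e) A \<and> h \<cdot>\<^bsub>C\<^esub> e = ?g"
          using coeq A g by (simp add: coequalizer_def)
        then show "\<exists>h\<in>hom C (Cod C e) A. ?g = h \<cdot>\<^bsub>C\<^esub> e"
          by (elim ex1_implies_ex[THEN exE] conjE) (rule bexI, rule sym)
      qed
      then show ?thesis
        using comp_assoc[OF r Fn.on_arr[OF f] \<epsilon>] comp_assoc[OF s Fn.on_arr[OF f] \<epsilon>]
          comp_assoc[OF c[rule_format, OF f] \<phi>A \<epsilon>] comp_assoc[OF c[rule_format, OF f] \<psi>A \<epsilon>] \<phi>_c[OF A f] \<psi>_c[OF A f]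
        by simp
    qed
    \<comment> \<open>The copower injections are jointly epic.\<close>
    have "?\<epsilon> \<cdot>\<^bsub>C\<^esub> \<phi> A = ?\<epsilon> \<cdot>\<^bsub>C\<^esub> \<psi> A \<longleftrightarrow>
        (\<forall>f\<in>hom C X A. (?\<epsilon> \<cdot>\<^bsub>C\<^esub> \<phi> A) \<cdot>\<^bsub>C\<^esub> c A f = (?\<epsilon> \<cdot>\<^bsub>C\<^esub> \<psi> A) \<cdot>\<^bsub>C\<^esub> c A f)"
      using ext[rule_format, OF A comp_hom[OF \<phi>A \<epsilon>] comp_hom[OF \<psi>A \<epsilon>]] by auto
    then show ?thesis
      by (simp add: satisfies_equation_def satisfies_identity_def eqn_eq factors)
  qed
  moreover have "(G, (n, \<phi>), (n, \<psi>)) \<in> natural_identities C F"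
    using G \<phi> \<psi> by (simp add: natural_identities_def G_terms_def)
  ultimately show ?thesis by (intro exI[of _ "(G, (n, \<phi>), (n, \<psi>))"]) auto
qed

lemma ex_equations_of_identity:
  fixes U :: "'k::ordinals itself" and I :: "('k, 'o, 'm) nat_identity"
  assumes coc: "cocomplete U C" and I: "I \<in> natural_identities C F"
  shows "\<exists>E :: ('o \<times> 'k \<times> 'm) set. E \<subseteq> equation_arrows C F \<and>
    (\<forall>a\<in>algebras C F. satisfies_identity C F a I \<longleftrightarrow> (\<forall>eqn\<in>E. satisfies_equation C F a eqn))"
proof -
  obtain G m \<phi>' n \<psi>' where I_eq: "I = (G, (m, \<phi>'), (n, \<psi>'))" by (cases I) auto
  note TD = is_term_chainD[OF term_chain_of[OF coc]]
  \<comment> \<open>Both terms are moved to a common arity, since a coequalizer needs a parallel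
    pair. By \<open>term_eval_link\<close> their values in algebras do not change.\<close>
  define l where "l = max m n"
  let ?Fl = "term_functor C F l"
  have ml: "m \<le> l" and nl: "n \<le> l" by (simp_all add: l_def)
  have G: "is_functor C C G" and \<phi>': "nat_trans C C G (term_functor C F m) \<phi>'"
    and \<psi>': "nat_trans C C G (term_functor C F n) \<psi>'"
    using I by (simp_all add: I_eq natural_identities_def G_terms_def)
  interpret G: is_functor C C G by (rule G)
  interpret Fl: is_functor C C ?Fl by (rule TD(1))
  define \<phi> where "\<phi> A = term_link C F m l A \<cdot>\<^bsub>C\<^esub> \<phi>' A" for A
  define \<psi> where "\<psi> A = term_link C F n l A \<cdot>\<^bsub>C\<^esub> \<psi>' A" for A
  have lifted: "nat_trans C C G ?Fl (\<lambda>A. term_link C F k l A \<cdot>\<^bsub>C\<^esub> \<chi> A)"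
    if kl: "k \<le> l" and \<chi>: "nat_trans C C G (term_functor C F k) \<chi>" for k \<chi>
    unfolding nat_trans_def
  proof (intro conjI ballI)
    interpret Fk: is_functor C C "term_functor C F k" by (rule TD(1))
    note w = nat_transD[OF TD(2)[OF kl]] and x = nat_transD[OF \<chi>]
    show "term_link C F k l A \<cdot>\<^bsub>C\<^esub> \<chi> A \<in> hom C (on_obj G A) (on_obj ?Fl A)" if "A \<in> Obj C" for A
      using x(1)[OF that] w(1)[OF that] by (rule comp_hom)
    show "(term_link C F k l B \<cdot>\<^bsub>C\<^esub> \<chi> B) \<cdot>\<^bsub>C\<^esub> on_arr G f = on_arr ?Fl f \<cdot>\<^bsub>C\<^esub> (term_link C F k l A \<cdot>\<^bsub>C\<^esub> \<chi> A)"
      if A: "A \<in> Obj C" and B: "B \<in> Obj C" and f: "f \<in> hom C A B" for A B f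
      using comp_assoc[OF G.on_arr[OF f] x(1)[OF B] w(1)[OF B]] x(2)[OF A B f]
        comp_assoc[OF x(1)[OF A] Fk.on_arr[OF f] w(1)[OF B]] w(2)[OF A B f]
        comp_assoc[OF x(1)[OF A] w(1)[OF A] Fl.on_arr[OF f]] by simp
  qed
  have \<phi>: "nat_trans C C G ?Fl \<phi>" and \<psi>: "nat_trans C C G ?Fl \<psi>"
    using lifted[OF ml \<phi>'] lifted[OF nl \<psi>'] by (simp_all add: \<phi>_def[abs_def] \<psi>_def[abs_def])
  have "\<forall>X\<in>Obj C. \<exists>e. coequalizer C (on_obj G X) (on_obj ?Fl X) (\<phi> X) (\<psi> X) (Cod C e) e"
  proof
    fix X assume X: "X \<in> Obj C"
    obtain z e where ze: "coequalizer C (on_obj G X) (on_obj ?Fl X) (\<phi> X) (\<psi> X) z e"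
      using nat_transD(1)[OF \<phi> X] nat_transD(1)[OF \<psi> X] by (rule ex_coequalizer[OF coc])
    then have "Cod C e = z" by (simp add: coequalizer_def hom_def)
    with ze show "\<exists>e. coequalizer C (on_obj G X) (on_obj ?Fl X) (\<phi> X) (\<psi> X) (Cod C e) e" by blast
  qed
  from bchoice[OF this] obtain e where
    coeq: "\<And>X. X \<in> Obj C \<Longrightarrow>
      coequalizer C (on_obj G X) (on_obj ?Fl X) (\<phi> X) (\<psi> X) (Cod C (e X)) (e X)" by blast
  have e: "e X \<in> hom C (on_obj ?Fl X) (Cod C (e X))" "e X \<cdot>\<^bsub>C\<^esub> \<phi> X = e X \<cdot>\<^bsub>C\<^esub> \<psi> X"
    if "X \<in> Obj C" for X using coeq[OF that] by (simp_all add: coequalizer_def)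
  \<comment> \<open>One equation arrow for each object: a possibly large class, matching a natural
    transformation's components at all objects.\<close>
  define E where "E = (\<lambda>X. (X, l, e X)) ` Obj C"
  have "(X, l, e X) \<in> equation_arrows C F" if X: "X \<in> Obj C" for X
  proof -
    have "Dom C (e X) = on_obj ?Fl X" using e(1)[OF X] by (simp add: hom_def)
    moreover from this coeq[OF X] have "regular_epi C (e X)" by (auto simp: regular_epi_def)
    ultimately show ?thesis using X by (simp add: equation_arrows_def)
  qed
  then have "E \<subseteq> equation_arrows C F" by (auto simp: E_def)
  moreover have "satisfies_identity C F (A, \<alpha>) I \<longleftrightarrow> (\<forall>eqn\<in>E. satisfies_equation C F (A, \<alpha>) eqn)"
    if alg: "(A, \<alpha>) \<in> algebras C F" for A \<alpha>
  proof -
    let ?\<epsilon> = "term_eval C F (A, \<alpha>) l"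
    have A: "A \<in> Obj C" using alg by (simp add: algebras_def)
    note \<epsilon> = term_eval_hom[OF coc alg, of l]
    have "?\<epsilon> \<cdot>\<^bsub>C\<^esub> \<phi> A = term_eval C F (A, \<alpha>) m \<cdot>\<^bsub>C\<^esub> \<phi>' A"
      using comp_assoc[OF nat_transD(1)[OF \<phi>' A] nat_transD(1)[OF TD(2)[OF ml] A] \<epsilon>]
        term_eval_link[OF coc alg ml] by (simp add: \<phi>_def)
    moreover have "?\<epsilon> \<cdot>\<^bsub>C\<^esub> \<psi> A = term_eval C F (A, \<alpha>) n \<cdot>\<^bsub>C\<^esub> \<psi>' A"
      using comp_assoc[OF nat_transD(1)[OF \<psi>' A] nat_transD(1)[OF TD(2)[OF nl] A] \<epsilon>]
        term_eval_link[OF coc alg nl] by (simp add: \<psi>_def)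
    ultimately have identity: "satisfies_identity C F (A, \<alpha>) I \<longleftrightarrow> ?\<epsilon> \<cdot>\<^bsub>C\<^esub> \<phi> A = ?\<epsilon> \<cdot>\<^bsub>C\<^esub> \<psi> A"
      by (simp add: satisfies_identity_def I_eq)
    show ?thesis
      unfolding identity
    proof
      assume eq: "?\<epsilon> \<cdot>\<^bsub>C\<^esub> \<phi> A = ?\<epsilon> \<cdot>\<^bsub>C\<^esub> \<psi> A"
      have "\<exists>h\<in>hom C (Cod C (e X)) A. ?\<epsilon> \<cdot>\<^bsub>C\<^esub> on_arr ?Fl f = h \<cdot>\<^bsub>C\<^esub> e X"
        if f: "f \<in> hom C X A" for X f
      proof -
        note X = hom_obj(1)[OF f]
        note \<phi>X = nat_transD[OF \<phi>] and \<psi>X = nat_transD[OF \<psi>]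
        let ?g = "?\<epsilon> \<cdot>\<^bsub>C\<^esub> on_arr ?Fl f"
        have g: "?g \<in> hom C (on_obj ?Fl X) A" using Fl.on_arr[OF f] \<epsilon> by (rule comp_hom)
        \<comment> \<open>Naturality carries \<open>f\<close> to the other side, where the identity
          over \<open>A\<close> applies; hence \<open>?g\<close> factors through the coequalizer
          over \<open>X\<close>.\<close>
        have "?g \<cdot>\<^bsub>C\<^esub> \<phi> X = (?\<epsilon> \<cdot>\<^bsub>C\<^esub> \<phi> A) \<cdot>\<^bsub>C\<^esub> on_arr G f"
          using comp_assoc[OF \<phi>X(1)[OF X] Fl.on_arr[OF f] \<epsilon>] \<phi>X(2)[OF X A f]
            comp_assoc[OF G.on_arr[OF f] \<phi>X(1)[OF A] \<epsilon>] by simp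
        also have "\<dots> = ?g \<cdot>\<^bsub>C\<^esub> \<psi> X"
          unfolding eq using comp_assoc[OF \<psi>X(1)[OF X] Fl.on_arr[OF f] \<epsilon>] \<psi>X(2)[OF X A f]
            comp_assoc[OF G.on_arr[OF f] \<psi>X(1)[OF A] \<epsilon>] by simp
        finally have "\<exists>!h. h \<in> hom C (Cod C (e X)) A \<and> h \<cdot>\<^bsub>C\<^esub> e X = ?g"
          using coeq[OF X] A g by (simp add: coequalizer_def)
        then show ?thesis by (elim ex1_implies_ex[THEN exE] conjE) (rule bexI, rule sym)
      qed
      then show "\<forall>eqn\<in>E. satisfies_equation C F (A, \<alpha>) eqn"
        by (auto simp: E_def satisfies_equation_def)
    next
      assume "\<forall>eqn\<in>E. satisfies_equation C F (A, \<alpha>) eqn"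
      \<comment> \<open>Taking the equation over the carrier itself at the identity, evaluation
        factors through \<open>e A\<close>, which equalizes \<open>\<phi> A\<close> and
        \<open>\<psi> A\<close>.\<close>
      then have "satisfies_equation C F (A, \<alpha>) (A, l, e A)" using A by (simp add: E_def)
      then obtain h where h: "h \<in> hom C (Cod C (e A)) A"
        and "?\<epsilon> \<cdot>\<^bsub>C\<^esub> on_arr ?Fl (Ide C A) = h \<cdot>\<^bsub>C\<^esub> e A"
        using ide_hom[OF A] by (auto simp: satisfies_equation_def)
      then have "?\<epsilon> = h \<cdot>\<^bsub>C\<^esub> e A"
        using Fl.on_ide[OF A] ide_right[OF \<epsilon>] by simp
      then show "?\<epsilon> \<cdot>\<^bsub>C\<^esub> \<phi> A = ?\<epsilon> \<cdot>\<^bsub>C\<^esub> \<psi> A"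
        using comp_assoc[OF nat_transD(1)[OF \<phi> A] e(1)[OF A] h]
          comp_assoc[OF nat_transD(1)[OF \<psi> A] e(1)[OF A] h] e(2)[OF A] by simp
    qed
  qed
  ultimately show ?thesis by (intro exI[of _ E]) auto
qed

end

section \<open>From single equations and identities to classes\<close>

theorem theorem1p8:
  fixes C :: "('o, 'm) cat"
    and F :: "('o, 'm) endo"
    and K :: "('o \<times> 'm) set"
  assumes "category C"
    and "locally_small TYPE('k::ordinals) C"
    and "cocomplete TYPE('k) C"
    and "is_functor C C F"
    and "K \<subseteq> algebras C F"
  shows "(\<exists>\<E> :: ('o \<times> 'k \<times> 'm) set.
            \<E> \<subseteq> equation_arrows C F \<and> K = Alg_equations C F \<E>)
     \<longleftrightarrow> (\<exists>\<I> :: ('k, 'o, 'm) nat_identity set.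
            \<I> \<subseteq> natural_identities C F \<and> K = Alg_identities C F \<I>)"
proof
  interpret endofunctor C F
    using assms(1,4) by (rule endofunctor.intro)
  show "\<exists>\<I> :: ('k, 'o, 'm) nat_identity set.
      \<I> \<subseteq> natural_identities C F \<and> K = Alg_identities C F \<I>"
    if "\<exists>\<E> :: ('o \<times> 'k \<times> 'm) set. \<E> \<subseteq> equation_arrows C F \<and> K = Alg_equations C F \<E>"
  proof -
    from that obtain \<E> :: "('o \<times> 'k \<times> 'm) set"
      where \<E>: "\<E> \<subseteq> equation_arrows C F" and K: "K = Alg_equations C F \<E>" by blast
    have "\<forall>eqn\<in>\<E>. \<exists>I :: ('k, 'o, 'm) nat_identity. I \<in> natural_identities C F \<and>
        (\<forall>a\<in>algebras C F. satisfies_equation C F a eqn \<longleftrightarrow> satisfies_identity C F a I)"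
      using \<E> by (intro ballI ex_identity_of_equation[OF assms(3,2)]) (rule subsetD)
    from bchoice[OF this] obtain I :: "'o \<times> 'k \<times> 'm \<Rightarrow> ('k, 'o, 'm) nat_identity"
      where I: "\<forall>eqn\<in>\<E>. I eqn \<in> natural_identities C F \<and> (\<forall>a\<in>algebras C F.
        satisfies_equation C F a eqn \<longleftrightarrow> satisfies_identity C F a (I eqn))" by (rule exE)
    then have "K = Alg_identities C F (I ` \<E>)"
      by (auto simp: K Alg_equations_def Alg_identities_def)
    with I show ?thesis by (intro exI[of _ "I ` \<E>"]) auto
  qed
  show "\<exists>\<E> :: ('o \<times> 'k \<times> 'm) set. \<E> \<subseteq> equation_arrows C F \<and> K = Alg_equations C F \<E>"
    if "\<exists>\<I> :: ('k, 'o, 'm) nat_identity set.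
      \<I> \<subseteq> natural_identities C F \<and> K = Alg_identities C F \<I>"
  proof -
    from that obtain \<I> :: "('k, 'o, 'm) nat_identity set"
      where \<I>: "\<I> \<subseteq> natural_identities C F" and K: "K = Alg_identities C F \<I>" by blast
    have "\<forall>I\<in>\<I>. \<exists>E :: ('o \<times> 'k \<times> 'm) set. E \<subseteq> equation_arrows C F \<and> (\<forall>a\<in>algebras C F.
        satisfies_identity C F a I \<longleftrightarrow> (\<forall>eqn\<in>E. satisfies_equation C F a eqn))"
      using \<I> by (intro ballI ex_equations_of_identity[OF assms(3)]) (rule subsetD)
    from bchoice[OF this] obtain E :: "('k, 'o, 'm) nat_identity \<Rightarrow> ('o \<times> 'k \<times> 'm) set"
      where E: "\<forall>I\<in>\<I>. E I \<subseteq> equation_arrows C F \<and> (\<forall>a\<in>algebras C F.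
        satisfies_identity C F a I \<longleftrightarrow> (\<forall>eqn\<in>E I. satisfies_equation C F a eqn))" by (rule exE)
    \<comment> \<open>Each identity contributes a whole class of equation arrows, so here a union is
      taken where the other direction needs only an image.\<close>
    then have "K = Alg_equations C F (\<Union>I\<in>\<I>. E I)"
      by (auto simp: K Alg_equations_def Alg_identities_def)
    with E show ?thesis by (intro exI[of _ "\<Union>I\<in>\<I>. E I"]) auto
  qed
qed

end
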